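(* Let $M$ be a hypersurface in the Euclidean space $\mathbb{E}^{n+1}$ with induced Riemannian metric $g$. Let $V$ be the position vector field of $\mathbb{E}^{n+1}$ and let $V^T$ be its tangential component along $M$. If $(M,g,V^T,\varphi)$ is a conformal soliton for some smooth function $\varphi:M\to\mathbb{R}$, then $M$ is contained in a hyperplane, a conic hypersurface or a hypersphere.
   Context: All manifolds are assumed to be smooth, orientable and connected. A conformal soliton $(M,g,v,\varphi)$ is a Riemannian manifold $(M,g)$ together with a complete vector field $v$ on $M$ and a smooth function $\varphi:M\to\mathbb{R}$ such that $\varphi g=\frac12\mathcal{L}_v g$, where $\mathcal{L}_v g$ is the Lie derivative of $g$ along $v$. The position vector field $V$ of $\mathbb{E}^{n+1}$ assigns to each point $x$ the vector $x$. Along $M$ write $V=V^T+V^\perp$ with $V^T$ tangent and $V^\perp$ normal to $M$. A hypersurface of $\mathbb{E}^{n+1}$ is an $n$-dimensional submanifold. A submanifold of a Euclidean space is called conic if it is an open portion of a cone with vertex at the origin (so $n$-dimensional planes through the origin are included among the $n$-dimensional conic submanifolds); a conic hypersurface is a conic submanifold of dimension $n$ in $\mathbb{E}^{n+1}$.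
   Formalization: The dimension of the hypersurface is assumed to be n ≥ 2; for n = 1 the claim fails, e.g. for the ellipse x²/4 + y² = 1 in the plane, where the soliton equation holds automatically and V^T is complete by compactness. *)

theory Defs
  imports "HOL-Analysis.Analysis"
begin

text \<open>
  Conventions. The ambient Euclidean space is a type of class \<open>euclidean_space\<close>. Submanifolds are
  embedded, i.e. subsets carrying the subspace topology. The dimension of a submanifold is
  \<open>CARD('n)\<close>, where \<open>real^'n\<close> is the type of the chart domains; predicates in which \<open>'n\<close> would not
  be determined by the other arguments take it as an argument of type \<open>'n itself\<close>.
\<close>

subsection \<open>Smooth maps on open subsets of Euclidean spaces\<close>

text \<open>These notions are meant for open sets \<open>S\<close> in finite dimension, where continuity of all
  iterated directional derivatives is equivalent to being of class \<open>C\<^sup>k\<close>.\<close>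

primrec Ck_on :: "nat \<Rightarrow> 'a::real_normed_vector set \<Rightarrow> ('a \<Rightarrow> 'b::real_normed_vector) \<Rightarrow> bool" where
  "Ck_on 0 S f \<longleftrightarrow> continuous_on S f"
| "Ck_on (Suc k) S f \<longleftrightarrow>
     (\<forall>x\<in>S. f differentiable (at x)) \<and> (\<forall>v. Ck_on k S (\<lambda>x. frechet_derivative f (at x) v))"

definition smooth_on :: "'a::real_normed_vector set \<Rightarrow> ('a \<Rightarrow> 'b::real_normed_vector) \<Rightarrow> bool" where
  "smooth_on S f \<longleftrightarrow> (\<forall>k. Ck_on k S f)"

subsection \<open>Submanifolds of Euclidean space\<close>

definition local_parametrization ::
  "'a::euclidean_space set \<Rightarrow> (real^'n) set \<Rightarrow> (real^'n \<Rightarrow> 'a) \<Rightarrow> bool" where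
  "local_parametrization M U \<psi> \<longleftrightarrow>
     open U \<and> smooth_on U \<psi> \<and>
     (\<forall>u\<in>U. inj (frechet_derivative \<psi> (at u))) \<and>
     openin (top_of_set M) (\<psi> ` U) \<and>
     (\<exists>\<eta>. homeomorphism U (\<psi> ` U) \<psi> \<eta>)"

definition oriented_atlas ::
  "'a::euclidean_space set \<Rightarrow> ((real^'n) set \<times> (real^'n \<Rightarrow> 'a)) set \<Rightarrow> bool" where
  "oriented_atlas M A \<longleftrightarrow>
     (\<forall>(U, \<psi>)\<in>A. local_parametrization M U \<psi>) \<and>
     M = (\<Union>(U, \<psi>)\<in>A. \<psi> ` U) \<and>
     (\<forall>(U, \<psi>)\<in>A. \<forall>(W, \<eta>)\<in>A. \<forall>u\<in>U. \<psi> u \<in> \<eta> ` W \<longrightarrow>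
        det (jacobian (inv_into W \<eta> \<circ> \<psi>) (at u)) > 0)"

text \<open>All manifolds are smooth, connected and orientable.\<close>

definition submanifold :: "'n::finite itself \<Rightarrow> 'a::euclidean_space set \<Rightarrow> bool" where
  "submanifold N M \<longleftrightarrow>
     (\<forall>p\<in>M. \<exists>(U::(real^'n) set) \<psi>. local_parametrization M U \<psi> \<and> p \<in> \<psi> ` U) \<and>
     connected M \<and>
     (\<exists>A::((real^'n) set \<times> (real^'n \<Rightarrow> 'a)) set. oriented_atlas M A)"

definition hypersurface :: "'n::finite itself \<Rightarrow> 'a::euclidean_space set \<Rightarrow> bool" where
  "hypersurface N M \<longleftrightarrow> DIM('a) = CARD('n) + 1 \<and> submanifold N M"

text \<open>An open portion of a cone with vertex at the origin; the library's \<^const>\<open>cone\<close> is a union of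
  closed rays from the origin. The cone itself need not be smooth at the origin.\<close>

definition conic_submanifold :: "'n::finite itself \<Rightarrow> 'a::euclidean_space set \<Rightarrow> bool" where
  "conic_submanifold N M \<longleftrightarrow> submanifold N M \<and> (\<exists>C. cone C \<and> openin (top_of_set C) M)"

definition conic_hypersurface :: "'n::finite itself \<Rightarrow> 'a::euclidean_space set \<Rightarrow> bool" where
  "conic_hypersurface N M \<longleftrightarrow> hypersurface N M \<and> conic_submanifold N M"

subsection \<open>Tangent spaces, functions and vector fields\<close>

text \<open>Velocities at \<open>p\<close> of smooth curves in \<open>M\<close>.\<close>

definition tangent_space :: "'a::euclidean_space set \<Rightarrow> 'a \<Rightarrow> 'a set" where
  "tangent_space M p =
     {w. \<exists>(c::real \<Rightarrow> 'a) e. e > 0 \<and> smooth_on {-e<..<e} c \<and> c ` {-e<..<e} \<subseteq> M \<and>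
           c 0 = p \<and> (c has_vector_derivative w) (at 0)}"

definition smooth_map_on_manifold ::
  "'n::finite itself \<Rightarrow> 'a::euclidean_space set \<Rightarrow> ('a \<Rightarrow> 'b::real_normed_vector) \<Rightarrow> bool" where
  "smooth_map_on_manifold N M f \<longleftrightarrow>
     (\<forall>(U::(real^'n) set) \<psi>. local_parametrization M U \<psi> \<longrightarrow> smooth_on U (f \<circ> \<psi>))"

definition smooth_vector_field ::
  "'n::finite itself \<Rightarrow> 'a::euclidean_space set \<Rightarrow> ('a \<Rightarrow> 'a) \<Rightarrow> bool" where
  "smooth_vector_field N M v \<longleftrightarrow>
     (\<forall>p\<in>M. v p \<in> tangent_space M p) \<and> smooth_map_on_manifold N M v"

definition complete_vector_field :: "'a::euclidean_space set \<Rightarrow> ('a \<Rightarrow> 'a) \<Rightarrow> bool" where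
  "complete_vector_field M v \<longleftrightarrow>
     (\<forall>p\<in>M. \<exists>c::real \<Rightarrow> 'a. c 0 = p \<and>
        (\<forall>t. c t \<in> M \<and> (c has_vector_derivative v (c t)) (at t)))"

definition position_field :: "'a::euclidean_space \<Rightarrow> 'a" where
  "position_field x = x"

text \<open>The component \<open>V\<^sup>T\<close> in the decomposition of \<open>V\<close> along \<open>M\<close> into a tangent and a normal part.\<close>

definition tangential_component ::
  "'a::euclidean_space set \<Rightarrow> ('a \<Rightarrow> 'a) \<Rightarrow> 'a \<Rightarrow> 'a" where
  "tangential_component M V p =
     (THE w. w \<in> tangent_space M p \<and> V p - w \<in> orthogonal_comp (tangent_space M p))"

subsection \<open>Riemannian metrics and Lie derivatives\<close>

text \<open>A metric assigns to each \<open>p\<close> a function of two ambient vectors; only its values on tangent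
  vectors at points of \<open>M\<close> matter. The following two functions are the local expressions of a
  metric and of a tangent vector field with respect to a local parametrization.\<close>

definition pullback_metric ::
  "(real^'n \<Rightarrow> 'a::euclidean_space) \<Rightarrow> ('a \<Rightarrow> 'a \<Rightarrow> 'a \<Rightarrow> real) \<Rightarrow>
     real^'n \<Rightarrow> real^'n \<Rightarrow> real^'n \<Rightarrow> real" where
  "pullback_metric \<psi> g u a b =
     g (\<psi> u) (frechet_derivative \<psi> (at u) a) (frechet_derivative \<psi> (at u) b)"

definition pullback_field ::
  "(real^'n \<Rightarrow> 'a::euclidean_space) \<Rightarrow> ('a \<Rightarrow> 'a) \<Rightarrow> real^'n \<Rightarrow> real^'n" where
  "pullback_field \<psi> v u = (THE w. frechet_derivative \<psi> (at u) w = v (\<psi> u))"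

definition riemannian_metric ::
  "'n::finite itself \<Rightarrow> 'a::euclidean_space set \<Rightarrow> ('a \<Rightarrow> 'a \<Rightarrow> 'a \<Rightarrow> real) \<Rightarrow> bool" where
  "riemannian_metric N M g \<longleftrightarrow>
     (\<forall>p\<in>M. \<forall>X\<in>tangent_space M p. \<forall>Y\<in>tangent_space M p.
        g p X Y = g p Y X \<and> (X \<noteq> 0 \<longrightarrow> g p X X > 0) \<and>
        (\<forall>Z\<in>tangent_space M p. \<forall>r. g p (r *\<^sub>R X + Y) Z = r * g p X Z + g p Y Z)) \<and>
     (\<forall>(U::(real^'n) set) \<psi> a b. local_parametrization M U \<psi> \<longrightarrow>
        smooth_on U (\<lambda>u. pullback_metric \<psi> g u a b))"

definition induced_metric :: "'a::euclidean_space \<Rightarrow> 'a \<Rightarrow> 'a \<Rightarrow> real" where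
  "induced_metric p X Y = X \<bullet> Y"

text \<open>The Lie derivative of \<open>g\<close> along \<open>v\<close> in local coordinates, evaluated at \<open>(a, b)\<close>:
  \<open>(L\<^sub>v g)\<^sub>i\<^sub>j = v\<^sup>k \<partial>\<^sub>k g\<^sub>i\<^sub>j + g\<^sub>k\<^sub>j \<partial>\<^sub>i v\<^sup>k + g\<^sub>i\<^sub>k \<partial>\<^sub>j v\<^sup>k\<close>.\<close>

definition pullback_lie_derivative ::
  "(real^'n \<Rightarrow> 'a::euclidean_space) \<Rightarrow> ('a \<Rightarrow> 'a) \<Rightarrow> ('a \<Rightarrow> 'a \<Rightarrow> 'a \<Rightarrow> real) \<Rightarrow>
     real^'n \<Rightarrow> real^'n \<Rightarrow> real^'n \<Rightarrow> real" where
  "pullback_lie_derivative \<psi> v g u a b =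
     frechet_derivative (\<lambda>x. pullback_metric \<psi> g x a b) (at u) (pullback_field \<psi> v u) +
     pullback_metric \<psi> g u (frechet_derivative (pullback_field \<psi> v) (at u) a) b +
     pullback_metric \<psi> g u a (frechet_derivative (pullback_field \<psi> v) (at u) b)"

text \<open>The equation \<open>\<phi> g = (1/2) L\<^sub>v g\<close> between tensor fields on \<open>M\<close> is expressed by equality of
  all components in all local parametrizations.\<close>

definition conformal_soliton ::
  "'n::finite itself \<Rightarrow> 'a::euclidean_space set \<Rightarrow> ('a \<Rightarrow> 'a \<Rightarrow> 'a \<Rightarrow> real) \<Rightarrow>
     ('a \<Rightarrow> 'a) \<Rightarrow> ('a \<Rightarrow> real) \<Rightarrow> bool" where
  "conformal_soliton N M g v \<phi> \<longleftrightarrow>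
     submanifold N M \<and> riemannian_metric N M g \<and>
     smooth_vector_field N M v \<and> complete_vector_field M v \<and>
     smooth_map_on_manifold N M \<phi> \<and>
     (\<forall>(U::(real^'n) set) \<psi>. local_parametrization M U \<psi> \<longrightarrow>
        (\<forall>u\<in>U. \<forall>a b. \<phi> (\<psi> u) * pullback_metric \<psi> g u a b =
                       1/2 * pullback_lie_derivative \<psi> v g u a b))"

subsection \<open>Hyperplanes and hyperspheres\<close>

definition hyperplane :: "'a::euclidean_space set \<Rightarrow> bool" where
  "hyperplane H \<longleftrightarrow> (\<exists>a b. a \<noteq> 0 \<and> H = {x. a \<bullet> x = b})"

definition hypersphere :: "'a::euclidean_space set \<Rightarrow> bool" where
  "hypersphere S \<longleftrightarrow> (\<exists>c r. r > 0 \<and> S = sphere c r)"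

end

theory Submission
  imports Defs
begin

text \<open>Write \<open>T\<close> for the tangential and \<open>Q = V - T\<close> for the normal part of the position field along \<open>M\<close>,
  and \<open>h = 1 - \<phi>\<close>. In a chart \<open>\<psi>\<close> the Lie derivative of the induced metric along \<open>T\<close> is
  \<open>D\<^sub>a T \<bullet> D\<^sub>b \<psi> + D\<^sub>b T \<bullet> D\<^sub>a \<psi>\<close>, and both terms agree because the second fundamental form is
  symmetric. The soliton equation therefore says
  \<open>D\<^sub>a Q \<bullet> D\<^sub>b \<psi> = h (D\<^sub>a \<psi> \<bullet> D\<^sub>b \<psi>)\<close>:
  the shape operator in the direction \<open>Q\<close> is a multiple of the identity
  (\<open>normal_part_umbilic\<close>).

  Where \<open>Q \<noteq> 0\<close> the hypersurface is thus totally umbilic, and the classical argument for \<open>n \<ge> 2\<close> applies: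
  the unit normal is \<open>N = Q / |Q| = \<mu> x + e\<close> with \<open>\<mu>\<close> and \<open>e\<close> locally constant. Since moreover
  \<open>|Q| = \<mu>/2 |x|\<^sup>2 + k\<close> with \<open>k\<close> locally constant, a connected patch lies in the set
  \<open>\<mu>/2 |x|\<^sup>2 + x \<bullet> e = k\<close>, which is a hyperplane for \<open>\<mu> = 0\<close> and a hypersphere otherwise
  (\<open>patch_in_quadric\<close>). Treating both kinds as one family of quadrics avoids
  a case distinction.

  Where \<open>Q = 0\<close> on all of \<open>M\<close>, the position field is tangent to \<open>M\<close> and complete, so its flow
  \<open>p \<mapsto> exp t p\<close> preserves \<open>M\<close>, and \<open>M\<close> together with the origin is a cone.

  A hyperplane part has constant \<open>|Q| = k \<noteq> 0\<close> and therefore never reaches a zero of \<open>Q\<close>. The remaining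
  difficulty is that a spherical part of \<open>M\<close> might end at a point \<open>p\<close> with \<open>Q p = 0\<close>
  and be continued there by a piece of another kind; a sphere and a cone tangent to it fit together
  with one continuous derivative. Smoothness forbids this (\<open>extends_near_zero_normal\<close>). The identity
  \<open>d|Q|\<^sup>2 = h d|x|\<^sup>2\<close> shows that \<open>h\<close> vanishes at zeros of \<open>Q\<close> near \<open>p \<noteq> 0\<close>, while \<open>dh \<noteq> 0\<close> at
  \<open>p\<close> as a limit from the sphere; hence the zeros of \<open>Q\<close> have no interior point near \<open>p\<close>. The
  invariants \<open>\<mu>\<^sup>2\<close> and \<open>\<mu> e\<close>, which are unaffected by reversing the normal, are smooth functions of
  the derivatives of \<open>Q\<close>, \<open>h\<close> and \<open>\<psi>\<close> near \<open>p\<close>, so they are constant there, and the same sphere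
  continues past \<open>p\<close>. The origin is a single point and does not disconnect a chart of dimension
  at least two. A patch in a hyperplane or hypersphere thus spreads over its chart
  (\<open>connected_patch_in_quadric\<close>) and, \<open>M\<close> being connected, over \<open>M\<close>.\<close>

section \<open>Calculus of smooth maps\<close>

text \<open>The point comes last so that \<open>D v\<close> is an operator on functions; iterating it gives exactly the
  derivatives that occur in the recursion of \<open>Ck_on\<close>.\<close>

abbreviation D :: "'a::real_normed_vector \<Rightarrow> ('a \<Rightarrow> 'b::real_normed_vector) \<Rightarrow> 'a \<Rightarrow> 'b" where
  "D v f \<equiv> \<lambda>x. frechet_derivative f (at x) v"

lemma D_eqI: "(f has_derivative f') (at x) \<Longrightarrow> D v f x = f' v"
  using frechet_derivative_at by metis

lemma D_cong_open:
  assumes "open S" "x \<in> S" "\<And>y. y \<in> S \<Longrightarrow> f y = g y" "f differentiable (at x)"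
  shows "D v f x = D v g x"
  using frechet_derivative_transform_within_open[OF assms(4,1,2)] assms(3) by metis

lemma Ck_on_mono_Suc: "Ck_on (Suc k) S f \<Longrightarrow> Ck_on k S f"
proof (induction k arbitrary: f)
  case 0
  then show ?case
    by (auto intro!: continuous_at_imp_continuous_on differentiable_imp_continuous_within)
next
  case (Suc k)
  then show ?case by (metis Ck_on.simps(2))
qed

lemma Ck_on_cong:
  assumes "open S"
  shows "Ck_on k S f \<Longrightarrow> (\<And>x. x \<in> S \<Longrightarrow> f x = g x) \<Longrightarrow> Ck_on k S g"
proof (induction k arbitrary: f g)
  case 0
  then show ?case by (metis Ck_on.simps(1) continuous_on_cong)
next
  case (Suc k)
  have diff: "f differentiable (at x)" if "x \<in> S" for x
    using Suc.prems that by simp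
  have "g differentiable (at x)" if "x \<in> S" for x
    using diff[OF that] Suc.prems(2) that assms
    unfolding differentiable_def by (meson has_derivative_transform_within_open)
  moreover have "Ck_on k S (D v g)" for v
  proof (rule Suc.IH)
    show "Ck_on k S (D v f)" using Suc.prems by simp
    show "D v f x = D v g x" if "x \<in> S" for x
      by (rule D_cong_open[OF assms that Suc.prems(2) diff[OF that]])
  qed
  ultimately show ?case by simp
qed

lemma Ck_on_subset: "Ck_on k S f \<Longrightarrow> T \<subseteq> S \<Longrightarrow> Ck_on k T f"
proof (induction k arbitrary: f)
  case 0
  then show ?case using continuous_on_subset by auto
next
  case (Suc k)
  then show ?case by auto
qed

lemma Ck_on_const: "Ck_on k S (\<lambda>x. c)"
  by (induction k arbitrary: c) auto

lemma Ck_on_add: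
  assumes "open S"
  shows "Ck_on k S f \<Longrightarrow> Ck_on k S g \<Longrightarrow> Ck_on k S (\<lambda>x. f x + g x)"
proof (induction k arbitrary: f g)
  case 0
  then show ?case by (auto intro: continuous_intros)
next
  case (Suc k)
  have d: "f differentiable (at x)" "g differentiable (at x)" if "x \<in> S" for x
    using Suc.prems that by auto
  have "Ck_on k S (D v (\<lambda>x. f x + g x))" for v
  proof (rule Ck_on_cong[OF assms])
    show "Ck_on k S (\<lambda>x. D v f x + D v g x)"
      using Suc by simp
    show "D v f x + D v g x = D v (\<lambda>x. f x + g x) x" if "x \<in> S" for x
      using D_eqI[OF has_derivative_add[OF d[OF that, unfolded frechet_derivative_works]]] by metis
  qed
  then show ?case using d by auto
qed

lemma Ck_on_bilinear:
  assumes "open S" "bounded_bilinear p"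
  shows "Ck_on k S f \<Longrightarrow> Ck_on k S g \<Longrightarrow> Ck_on k S (\<lambda>x. p (f x) (g x))"
proof (induction k arbitrary: f g)
  case 0
  then show ?case using bounded_bilinear.continuous_on[OF assms(2)] by auto
next
  case (Suc k)
  have d: "f differentiable (at x)" "g differentiable (at x)" if "x \<in> S" for x
    using Suc.prems that by auto
  note hd = bounded_bilinear.FDERIV[OF assms(2) d[unfolded frechet_derivative_works]]
  have "Ck_on k S (D v (\<lambda>x. p (f x) (g x)))" for v
  proof (rule Ck_on_cong[OF assms(1)])
    have "Ck_on k S f" "Ck_on k S g" using Suc.prems Ck_on_mono_Suc by auto
    then show "Ck_on k S (\<lambda>x. p (f x) (D v g x) + p (D v f x) (g x))"
      using Suc by (intro Ck_on_add[OF assms(1)] Suc.IH) auto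
    show "p (f x) (D v g x) + p (D v f x) (g x) = D v (\<lambda>x. p (f x) (g x)) x" if "x \<in> S" for x
      using D_eqI[OF hd[OF that that]] by metis
  qed
  then show ?case using hd[THEN differentiableI] by auto
qed

text \<open>Real powers are closed under differentiation up to products, so one induction with arbitrary
  exponent yields square roots (for norms) and reciprocals at once.\<close>

lemma Ck_on_powr:
  fixes f :: "'a::real_normed_vector \<Rightarrow> real"
  assumes "open S" "\<And>x. x \<in> S \<Longrightarrow> f x > 0"
  shows "Ck_on k S f \<Longrightarrow> Ck_on k S (\<lambda>x. f x powr r)"
proof (induction k arbitrary: r)
  case 0
  have "\<forall>x\<in>S. f x \<noteq> 0" using assms(2) by (metis less_irrefl)
  with 0 show ?case by (auto intro!: continuous_on_powr continuous_on_const)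
next
  case (Suc k)
  have d: "(f has_derivative (\<lambda>v. D v f x)) (at x)" if "x \<in> S" for x
    using Suc.prems that frechet_derivative_works by auto
  have hd: "((\<lambda>x. f x powr r) has_derivative (\<lambda>v. r * (f x powr (r - 1) * D v f x))) (at x)"
    if "x \<in> S" for x
  proof -
    have "((\<lambda>x. f x powr r) has_derivative
            (\<lambda>v. f x powr r * (0 * ln (f x) + D v f x * r / f x))) (at x)"
      using assms(2)[OF that] by (intro has_derivative_powr[OF d[OF that]]) auto
    moreover have "f x powr (r - 1) = f x powr r / f x"
      using assms(2)[OF that] by (simp add: powr_diff)
    ultimately show ?thesis
      by (elim has_derivative_eq_rhs) (auto simp: fun_eq_iff)
  qed
  have "Ck_on k S (D v (\<lambda>x. f x powr r))" for v
  proof (rule Ck_on_cong[OF assms(1)])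
    have "Ck_on k S (\<lambda>x. f x powr (r - 1))" using Suc Ck_on_mono_Suc by blast
    moreover have "Ck_on k S (D v f)" using Suc.prems by simp
    ultimately show "Ck_on k S (\<lambda>x. r * (f x powr (r - 1) * D v f x))"
      by (intro Ck_on_bilinear[OF assms(1) bounded_bilinear_mult] Ck_on_const)
    show "r * (f x powr (r - 1) * D v f x) = D v (\<lambda>x. f x powr r) x" if "x \<in> S" for x
      using D_eqI[OF hd[OF that]] by metis
  qed
  moreover have "(\<lambda>x. f x powr r) differentiable (at x)" if "x \<in> S" for x
    using hd[OF that] by (rule differentiableI)
  ultimately show ?case by simp
qed

lemma Ck_on_compose_line:
  assumes "\<And>t. t \<in> I \<Longrightarrow> u + t *\<^sub>R a \<in> S" "open I"
  shows "Ck_on k S f \<Longrightarrow> Ck_on k I (\<lambda>t. f (u + t *\<^sub>R a))"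
proof (induction k arbitrary: f)
  case 0
  then show ?case using assms
    by (auto intro!: continuous_on_compose2[of S f] continuous_intros)
next
  case (Suc k)
  have hd: "((\<lambda>t. f (u + t *\<^sub>R a)) has_derivative (\<lambda>v. D (v *\<^sub>R a) f (u + t *\<^sub>R a))) (at t)"
    if "t \<in> I" for t
  proof -
    have "(f has_derivative (\<lambda>v. D v f (u + t *\<^sub>R a))) (at (u + t *\<^sub>R a))"
      using Suc.prems assms(1)[OF that] frechet_derivative_works by auto
    moreover have "((\<lambda>t. u + t *\<^sub>R a) has_derivative (\<lambda>v. v *\<^sub>R a)) (at t)"
      by (auto intro!: derivative_eq_intros)
    ultimately show ?thesis by (rule has_derivative_compose[rotated])
  qed
  have "Ck_on k I (D v (\<lambda>t. f (u + t *\<^sub>R a)))" for v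
  proof (rule Ck_on_cong[OF assms(2)])
    show "Ck_on k I (\<lambda>t. D (v *\<^sub>R a) f (u + t *\<^sub>R a))"
      using Suc by (intro Suc.IH) auto
    show "D (v *\<^sub>R a) f (u + t *\<^sub>R a) = D v (\<lambda>t. f (u + t *\<^sub>R a)) t" if "t \<in> I" for t
      using D_eqI[OF hd[OF that]] by metis
  qed
  then show ?case using hd[THEN differentiableI] by auto
qed

lemma smooth_on_D: "smooth_on S f \<Longrightarrow> smooth_on S (D v f)"
  unfolding smooth_on_def by (metis Ck_on.simps(2))

lemma smooth_on_has_derivative:
  "smooth_on S f \<Longrightarrow> x \<in> S \<Longrightarrow> (f has_derivative (\<lambda>v. D v f x)) (at x)"
  unfolding smooth_on_def by (metis (no_types) Ck_on.simps(2) frechet_derivative_works)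

lemma smooth_on_continuous_on: "smooth_on S f \<Longrightarrow> continuous_on S f"
  unfolding smooth_on_def by (metis Ck_on.simps(1))

lemma smooth_on_subset: "smooth_on S f \<Longrightarrow> T \<subseteq> S \<Longrightarrow> smooth_on T f"
  unfolding smooth_on_def using Ck_on_subset by blast

lemma smooth_on_cong:
  "open S \<Longrightarrow> smooth_on S f \<Longrightarrow> (\<And>x. x \<in> S \<Longrightarrow> f x = g x) \<Longrightarrow> smooth_on S g"
  unfolding smooth_on_def using Ck_on_cong by blast

lemma smooth_on_const: "smooth_on S (\<lambda>x. c)"
  unfolding smooth_on_def by (simp add: Ck_on_const)

context
  fixes S :: "'a::real_normed_vector set"
  assumes S: "open S"
begin

lemma smooth_on_add: "smooth_on S f \<Longrightarrow> smooth_on S g \<Longrightarrow> smooth_on S (\<lambda>x. f x + g x)"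
  unfolding smooth_on_def by (simp add: Ck_on_add[OF S])

lemma smooth_on_inner:
  fixes f :: "'a \<Rightarrow> 'b::real_inner"
  shows "smooth_on S f \<Longrightarrow> smooth_on S g \<Longrightarrow> smooth_on S (\<lambda>x. f x \<bullet> g x)"
  unfolding smooth_on_def by (simp add: Ck_on_bilinear[OF S bounded_bilinear_inner])

lemma smooth_on_scaleR:
  "smooth_on S f \<Longrightarrow> smooth_on S g \<Longrightarrow> smooth_on S (\<lambda>x. f x *\<^sub>R g x)"
  unfolding smooth_on_def by (simp add: Ck_on_bilinear[OF S bounded_bilinear_scaleR])

lemma smooth_on_mult:
  fixes f :: "'a \<Rightarrow> real"
  shows "smooth_on S f \<Longrightarrow> smooth_on S g \<Longrightarrow> smooth_on S (\<lambda>x. f x * g x)"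
  using smooth_on_scaleR[of f g] by simp

lemma smooth_on_diff: "smooth_on S f \<Longrightarrow> smooth_on S g \<Longrightarrow> smooth_on S (\<lambda>x. f x - g x)"
  using smooth_on_add[of f "\<lambda>x. (-1) *\<^sub>R g x"] smooth_on_scaleR[OF smooth_on_const[of S "-1"], of g]
  by simp

lemma smooth_on_powr:
  fixes f :: "'a \<Rightarrow> real"
  shows "smooth_on S f \<Longrightarrow> (\<And>x. x \<in> S \<Longrightarrow> f x > 0) \<Longrightarrow> smooth_on S (\<lambda>x. f x powr r)"
  unfolding smooth_on_def by (simp add: Ck_on_powr[OF S])

lemma smooth_on_inverse:
  fixes f :: "'a \<Rightarrow> real"
  assumes f: "smooth_on S f" and nz: "\<And>x. x \<in> S \<Longrightarrow> f x \<noteq> 0"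
  shows "smooth_on S (\<lambda>x. inverse (f x))"
proof (rule smooth_on_cong[OF S])
  \<comment> \<open>The square makes the base positive, as real powers require.\<close>
  show "smooth_on S (\<lambda>x. f x * (f x * f x) powr (-1))"
    using nz by (intro smooth_on_mult smooth_on_powr f) (auto simp: zero_less_mult_iff linorder_neq_iff)
  show "f x * (f x * f x) powr (-1) = inverse (f x)" if "x \<in> S" for x
    using nz[OF that] by (simp add: powr_minus_divide field_simps)
qed

lemma smooth_on_divide:
  fixes f :: "'a \<Rightarrow> real"
  shows "smooth_on S f \<Longrightarrow> smooth_on S g \<Longrightarrow> (\<And>x. x \<in> S \<Longrightarrow> g x \<noteq> 0) \<Longrightarrow> smooth_on S (\<lambda>x. f x / g x)"
  unfolding divide_inverse by (intro smooth_on_mult smooth_on_inverse)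

lemma smooth_on_norm:
  fixes f :: "'a \<Rightarrow> 'b::real_inner"
  assumes "smooth_on S f" and nz: "\<And>x. x \<in> S \<Longrightarrow> f x \<noteq> 0"
  shows "smooth_on S (\<lambda>x. norm (f x))"
proof (rule smooth_on_cong[OF S])
  show "smooth_on S (\<lambda>x. (f x \<bullet> f x) powr (1/2))"
    using nz by (intro smooth_on_powr smooth_on_inner assms) auto
qed (simp add: norm_eq_sqrt_inner powr_half_sqrt)

lemma smooth_on_sum:
  "(\<And>i. i \<in> A \<Longrightarrow> smooth_on S (f i)) \<Longrightarrow> smooth_on S (\<lambda>x. \<Sum>i\<in>A. f i x)"
  by (induction A rule: infinite_finite_induct) (auto simp: smooth_on_const smooth_on_add)

lemma smooth_on_prod:
  fixes f :: "'i \<Rightarrow> 'a \<Rightarrow> real"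
  shows "(\<And>i. i \<in> A \<Longrightarrow> smooth_on S (f i)) \<Longrightarrow> smooth_on S (\<lambda>x. \<Prod>i\<in>A. f i x)"
  by (induction A rule: infinite_finite_induct) (auto simp: smooth_on_const smooth_on_mult)

lemma smooth_on_det:
  fixes m :: "'a \<Rightarrow> real^'n^'n"
  assumes "\<And>i j. smooth_on S (\<lambda>x. m x $ i $ j)"
  shows "smooth_on S (\<lambda>x. det (m x))"
  unfolding det_def by (intro smooth_on_sum smooth_on_mult smooth_on_prod smooth_on_const assms)

lemma smooth_on_vec:
  fixes f :: "'a \<Rightarrow> real^'n"
  assumes "\<And>i. smooth_on S (\<lambda>x. f x $ i)"
  shows "smooth_on S f"
proof (rule smooth_on_cong[OF S])
  show "smooth_on S (\<lambda>x. \<Sum>i\<in>UNIV. f x $ i *\<^sub>R axis i 1)"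
    by (intro smooth_on_sum smooth_on_scaleR assms smooth_on_const)
qed (simp add: vec_eq_iff axis_def if_distrib cong: if_cong)

end

lemma smooth_on_compose_line:
  "smooth_on S f \<Longrightarrow> open I \<Longrightarrow> (\<And>t. t \<in> I \<Longrightarrow> u + t *\<^sub>R a \<in> S) \<Longrightarrow> smooth_on I (\<lambda>t. f (u + t *\<^sub>R a))"
  unfolding smooth_on_def using Ck_on_compose_line by blast

lemma D_inner:
  assumes "smooth_on S f" "smooth_on S g" "x \<in> S"
  shows "D v (\<lambda>x. f x \<bullet> g x) x = f x \<bullet> D v g x + D v f x \<bullet> g x"
  by (rule D_eqI[OF has_derivative_inner[OF assms(1,2)[THEN smooth_on_has_derivative, OF assms(3)]]])

lemma D_scaleR:
  assumes "smooth_on S f" "smooth_on S g" "x \<in> S"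
  shows "D v (\<lambda>x. f x *\<^sub>R g x) x = f x *\<^sub>R D v g x + D v f x *\<^sub>R g x"
  by (rule D_eqI[OF has_derivative_scaleR[OF assms(1,2)[THEN smooth_on_has_derivative, OF assms(3)]]])

lemma D_add:
  assumes "smooth_on S f" "smooth_on S g" "x \<in> S"
  shows "D v (\<lambda>x. f x + g x) x = D v f x + D v g x"
  by (rule D_eqI[OF has_derivative_add[OF assms(1,2)[THEN smooth_on_has_derivative, OF assms(3)]]])

lemma D_diff:
  assumes "smooth_on S f" "smooth_on S g" "x \<in> S"
  shows "D v (\<lambda>x. f x - g x) x = D v f x - D v g x"
  by (rule D_eqI[OF has_derivative_diff[OF assms(1,2)[THEN smooth_on_has_derivative, OF assms(3)]]])

lemma smooth_on_linear_D:
  assumes "smooth_on S f" "x \<in> S"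
  shows "linear (\<lambda>v. D v f x)"
  using smooth_on_has_derivative[OF assms] has_derivative_linear by blast

text \<open>The mean value theorem in direction \<open>a\<close> and then in direction \<open>b\<close>. The left hand side is symmetric
  in \<open>a\<close> and \<open>b\<close>, which is why mixed derivatives commute.\<close>

lemma second_difference:
  fixes f :: "'a::real_normed_vector \<Rightarrow> real"
  assumes "smooth_on S f" "t > 0"
    and S: "\<And>\<sigma> \<tau>. 0 \<le> \<sigma> \<Longrightarrow> \<sigma> \<le> t \<Longrightarrow> 0 \<le> \<tau> \<Longrightarrow> \<tau> \<le> t \<Longrightarrow> x + \<sigma> *\<^sub>R a + \<tau> *\<^sub>R b \<in> S"
  obtains \<sigma> \<tau> where "0 < \<sigma>" "\<sigma> < t" "0 < \<tau>" "\<tau> < t"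
    "f (x + t *\<^sub>R a + t *\<^sub>R b) - f (x + t *\<^sub>R a) - f (x + t *\<^sub>R b) + f x
       = t * t * D b (D a f) (x + \<sigma> *\<^sub>R a + \<tau> *\<^sub>R b)"
proof -
  have line: "DERIV (\<lambda>s. g (y + s *\<^sub>R c)) s :> D c g (y + s *\<^sub>R c)"
    if "smooth_on S g" "y + s *\<^sub>R c \<in> S" for g :: "'a \<Rightarrow> real" and y c s
  proof -
    have "((\<lambda>s. y + s *\<^sub>R c) has_derivative (\<lambda>v. v *\<^sub>R c)) (at s)"
      by (auto intro!: derivative_eq_intros)
    from has_derivative_compose[OF this smooth_on_has_derivative[OF that]]
    have "((\<lambda>s. g (y + s *\<^sub>R c)) has_derivative (\<lambda>v. D (v *\<^sub>R c) g (y + s *\<^sub>R c))) (at s)" .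
    moreover have "D (v *\<^sub>R c) g (y + s *\<^sub>R c) = D c g (y + s *\<^sub>R c) * v" for v
      using linear_scale[OF smooth_on_linear_D[OF that]] by simp
    ultimately show ?thesis
      unfolding has_field_derivative_def by (simp add: fun_eq_iff[symmetric])
  qed
  have "\<exists>\<sigma>. 0 < \<sigma> \<and> \<sigma> < t \<and>
      (f ((x + t *\<^sub>R b) + t *\<^sub>R a) - f (x + t *\<^sub>R a)) - (f ((x + t *\<^sub>R b) + 0 *\<^sub>R a) - f (x + 0 *\<^sub>R a))
      = (t - 0) * (D a f ((x + t *\<^sub>R b) + \<sigma> *\<^sub>R a) - D a f (x + \<sigma> *\<^sub>R a))"
    using S[of _ t] S[of _ 0] assms(2)
    by (intro MVT2[where f = "\<lambda>s. f ((x + t *\<^sub>R b) + s *\<^sub>R a) - f (x + s *\<^sub>R a)"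
          and f' = "\<lambda>s. D a f ((x + t *\<^sub>R b) + s *\<^sub>R a) - D a f (x + s *\<^sub>R a)"]
        DERIV_diff line assms(1)) (auto simp: ac_simps)
  then obtain \<sigma> where \<sigma>: "0 < \<sigma>" "\<sigma> < t"
    "(f ((x + t *\<^sub>R b) + t *\<^sub>R a) - f (x + t *\<^sub>R a)) - (f (x + t *\<^sub>R b) - f x)
      = t * (D a f ((x + t *\<^sub>R b) + \<sigma> *\<^sub>R a) - D a f (x + \<sigma> *\<^sub>R a))" by auto
  have "\<exists>\<tau>. 0 < \<tau> \<and> \<tau> < t \<and>
      D a f ((x + \<sigma> *\<^sub>R a) + t *\<^sub>R b) - D a f ((x + \<sigma> *\<^sub>R a) + 0 *\<^sub>R b)
       = (t - 0) * D b (D a f) ((x + \<sigma> *\<^sub>R a) + \<tau> *\<^sub>R b)"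
    using S[of \<sigma>] \<sigma> assms(2)
    by (intro MVT2[where f = "\<lambda>s. D a f ((x + \<sigma> *\<^sub>R a) + s *\<^sub>R b)"
          and f' = "\<lambda>s. D b (D a f) ((x + \<sigma> *\<^sub>R a) + s *\<^sub>R b)"]
        line smooth_on_D assms(1)) auto
  then obtain \<tau> where \<tau>: "0 < \<tau>" "\<tau> < t"
    "D a f (x + \<sigma> *\<^sub>R a + t *\<^sub>R b) - D a f (x + \<sigma> *\<^sub>R a) = t * D b (D a f) (x + \<sigma> *\<^sub>R a + \<tau> *\<^sub>R b)"
    by auto
  have e: "x + t *\<^sub>R b + \<sigma> *\<^sub>R a = x + \<sigma> *\<^sub>R a + t *\<^sub>R b" "x + t *\<^sub>R b + t *\<^sub>R a = x + t *\<^sub>R a + t *\<^sub>R b"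
    by (simp_all add: algebra_simps)
  show ?thesis
  proof (rule that)
    show "f (x + t *\<^sub>R a + t *\<^sub>R b) - f (x + t *\<^sub>R a) - f (x + t *\<^sub>R b) + f x
       = t * t * D b (D a f) (x + \<sigma> *\<^sub>R a + \<tau> *\<^sub>R b)"
      using \<sigma>(3)[unfolded e \<tau>(3)] by linarith
  qed (use \<sigma> \<tau> in auto)
qed

text \<open>Both mixed derivatives are approximated by the same second difference: if they differed by
  \<open>2 \<epsilon>\<close>, continuity would keep their values at nearby points apart, against the previous lemma.\<close>

lemma D_commute_real:
  fixes f :: "'a::real_normed_vector \<Rightarrow> real"
  assumes S: "open S" "x \<in> S" and f: "smooth_on S f"
  shows "D a (D b f) x = D b (D a f) x"
proof (rule ccontr)
  assume neq: "D a (D b f) x \<noteq> D b (D a f) x"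
  define \<epsilon> where "\<epsilon> = \<bar>D a (D b f) x - D b (D a f) x\<bar> / 2"
  have \<epsilon>: "\<epsilon> > 0" using neq by (simp add: \<epsilon>_def)
  have cont: "\<exists>d>0. \<forall>y. dist y x < d \<longrightarrow> \<bar>D c (D c' f) y - D c (D c' f) x\<bar> < \<epsilon>" for c c'
  proof -
    have "isCont (D c (D c' f)) x"
      using continuous_on_eq_continuous_at[OF S(1), of "D c (D c' f)"] S(2)
        smooth_on_continuous_on[OF smooth_on_D[OF smooth_on_D[OF f]]] by blast
    then show ?thesis
      using \<epsilon> unfolding continuous_at_eps_delta dist_real_def by blast
  qed
  obtain d1 where d1: "d1 > 0" "\<And>y. dist y x < d1 \<Longrightarrow> \<bar>D a (D b f) y - D a (D b f) x\<bar> < \<epsilon>"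
    using cont[where c = a and c' = b] that by (elim exE conjE) simp
  obtain d2 where d2: "d2 > 0" "\<And>y. dist y x < d2 \<Longrightarrow> \<bar>D b (D a f) y - D b (D a f) x\<bar> < \<epsilon>"
    using cont[where c = b and c' = a] that by (elim exE conjE) simp
  obtain d3 where d3: "d3 > 0" "\<And>y. dist y x < d3 \<Longrightarrow> y \<in> S"
    using S that unfolding open_dist by meson
  define d where "d = min d1 (min d2 d3)"
  \<comment> \<open>Every point of the parallelogram with sides t a, t b at x is within distance d of x.\<close>
  define t where "t = d / (2 * (norm a + norm b + 1))"
  have pos: "norm a + norm b + 1 > 0" by (simp add: add_nonneg_pos)
  have d: "d > 0" using d1 d2 d3 by (simp add: d_def)
  have t: "t > 0" using d pos by (simp add: t_def)
  have near: "dist (x + \<sigma> *\<^sub>R a + \<tau> *\<^sub>R b) x < d" "dist (x + \<sigma> *\<^sub>R b + \<tau> *\<^sub>R a) x < d"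
    if "0 \<le> \<sigma>" "\<sigma> \<le> t" "0 \<le> \<tau>" "\<tau> \<le> t" for \<sigma> \<tau>
  proof -
    have n: "norm (s *\<^sub>R v + s' *\<^sub>R w) < d"
      if "0 \<le> s" "s \<le> t" "0 \<le> s'" "s' \<le> t" "norm v + norm w = norm a + norm b" for s s' and v w :: 'a
    proof -
      have "norm (s *\<^sub>R v + s' *\<^sub>R w) \<le> s * norm v + s' * norm w"
        using norm_triangle_ineq[of "s *\<^sub>R v" "s' *\<^sub>R w"] that by simp
      also have "\<dots> \<le> t * norm v + t * norm w"
        using that by (intro add_mono mult_right_mono) auto
      also have "\<dots> = t * (norm a + norm b)" by (simp add: that(5)[symmetric] algebra_simps)
      also have "\<dots> \<le> t * (norm a + norm b + 1)" using t by simp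
      also have "\<dots> = d / 2" using pos unfolding t_def by (simp add: divide_simps)
      also have "\<dots> < d" using d by simp
      finally show ?thesis .
    qed
    have "norm (\<sigma> *\<^sub>R a + \<tau> *\<^sub>R b) < d" "norm (\<sigma> *\<^sub>R b + \<tau> *\<^sub>R a) < d"
      by (rule n[OF that], simp)+
    then show "dist (x + \<sigma> *\<^sub>R a + \<tau> *\<^sub>R b) x < d" "dist (x + \<sigma> *\<^sub>R b + \<tau> *\<^sub>R a) x < d"
      by (simp_all add: dist_norm add.assoc)
  qed
  have inS: "x + \<sigma> *\<^sub>R a + \<tau> *\<^sub>R b \<in> S" "x + \<sigma> *\<^sub>R b + \<tau> *\<^sub>R a \<in> S"
    if "0 \<le> \<sigma>" "\<sigma> \<le> t" "0 \<le> \<tau>" "\<tau> \<le> t" for \<sigma> \<tau>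
    using near[OF that] d3(2) by (auto simp: d_def)
  obtain \<sigma> \<tau> where 1: "0 < \<sigma>" "\<sigma> < t" "0 < \<tau>" "\<tau> < t"
    "f (x + t *\<^sub>R a + t *\<^sub>R b) - f (x + t *\<^sub>R a) - f (x + t *\<^sub>R b) + f x
       = t * t * D b (D a f) (x + \<sigma> *\<^sub>R a + \<tau> *\<^sub>R b)"
    by (rule second_difference[OF f t inS(1)])
  obtain \<sigma>' \<tau>' where 2: "0 < \<sigma>'" "\<sigma>' < t" "0 < \<tau>'" "\<tau>' < t"
    "f (x + t *\<^sub>R b + t *\<^sub>R a) - f (x + t *\<^sub>R b) - f (x + t *\<^sub>R a) + f x
       = t * t * D a (D b f) (x + \<sigma>' *\<^sub>R b + \<tau>' *\<^sub>R a)"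
    by (rule second_difference[OF f t inS(2)])
  have e: "x + t *\<^sub>R b + t *\<^sub>R a = x + t *\<^sub>R a + t *\<^sub>R b" by simp
  have "t * t * D a (D b f) (x + \<sigma>' *\<^sub>R b + \<tau>' *\<^sub>R a) = t * t * D b (D a f) (x + \<sigma> *\<^sub>R a + \<tau> *\<^sub>R b)"
    using 1(5) 2(5)[unfolded e] by linarith
  then have eq: "D a (D b f) (x + \<sigma>' *\<^sub>R b + \<tau>' *\<^sub>R a) = D b (D a f) (x + \<sigma> *\<^sub>R a + \<tau> *\<^sub>R b)"
    using t by simp
  have "\<bar>D a (D b f) (x + \<sigma>' *\<^sub>R b + \<tau>' *\<^sub>R a) - D a (D b f) x\<bar> < \<epsilon>"
    using near(2)[of \<sigma>' \<tau>'] 2 by (intro d1(2)) (auto simp: d_def)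
  moreover have "\<bar>D b (D a f) (x + \<sigma> *\<^sub>R a + \<tau> *\<^sub>R b) - D b (D a f) x\<bar> < \<epsilon>"
    using near(1)[of \<sigma> \<tau>] 1 by (intro d2(2)) (auto simp: d_def)
  moreover have "\<bar>D a (D b f) x - D b (D a f) x\<bar> = 2 * \<epsilon>" by (simp add: \<epsilon>_def)
  ultimately show False using eq by linarith
qed

lemma D_inner_const:
  assumes "smooth_on S f" "x \<in> S"
  shows "D v (\<lambda>x. f x \<bullet> c) x = D v f x \<bullet> c"
  using D_inner[OF assms(1) smooth_on_const assms(2)] by simp

lemma D_commute:
  fixes f :: "'a::real_normed_vector \<Rightarrow> 'b::real_inner" and a b x :: 'a
  assumes S: "open S" "x \<in> S" and f: "smooth_on S f"
  shows "D a (D b f) x = D b (D a f) x"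
proof -
  have "D v (D w (\<lambda>x. f x \<bullet> c)) x = D v (D w f) x \<bullet> c" for v w :: 'a and c
  proof -
    have "D v (D w (\<lambda>x. f x \<bullet> c)) x = D v (\<lambda>x. D w f x \<bullet> c) x"
    proof (rule D_cong_open[OF S])
      show "D w (\<lambda>x. f x \<bullet> c) differentiable at x"
        using smooth_on_has_derivative[OF smooth_on_D[OF smooth_on_inner[OF S(1) f smooth_on_const]] S(2)]
        unfolding differentiable_def by blast
    qed (rule D_inner_const[OF f])
    also have "\<dots> = D v (D w f) x \<bullet> c" by (rule D_inner_const[OF smooth_on_D[OF f] S(2)])
    finally show ?thesis .
  qed
  then have "D a (D b f) x \<bullet> c = D b (D a f) x \<bullet> c" for c
    using D_commute_real[OF S smooth_on_inner[OF S(1) f smooth_on_const], where a = a and b = b] by metis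
  then show ?thesis by (metis inner_commute vector_eq_ldot)
qed

section \<open>Quadrics with a unit normal\<close>

lemma D_const_on_open:
  assumes "open S" "x \<in> S" "\<And>y. y \<in> S \<Longrightarrow> g y = c"
  shows "D v g x = 0"
  using D_cong_open[OF assms(1,2), of "\<lambda>_. c" g v] assms(3) by simp

lemma eq_on_closure:
  fixes f g :: "'a::euclidean_space \<Rightarrow> 'b::real_normed_vector"
  assumes "open U" "continuous_on U f" "continuous_on U g" "A \<subseteq> U" "\<And>x. x \<in> A \<Longrightarrow> f x = g x"
    and p: "p \<in> closure A" "p \<in> U"
  shows "f p = g p"
proof -
  obtain X where X: "\<And>n. X n \<in> A" "X \<longlonglongrightarrow> p"
    using p(1) unfolding closure_sequential by blast
  have "isCont f p" "isCont g p"
    using assms(1-3) p(2) by (auto simp: continuous_on_eq_continuous_at)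
  then have "(\<lambda>n. f (X n)) \<longlonglongrightarrow> f p" "(\<lambda>n. g (X n)) \<longlonglongrightarrow> g p"
    using isCont_tendsto_compose[OF _ X(2)] by blast+
  moreover have "(\<lambda>n. f (X n)) = (\<lambda>n. g (X n))" using X assms(5) by auto
  ultimately show ?thesis using LIMSEQ_unique by metis
qed

lemma open_nonzero:
  fixes f :: "'a::topological_space \<Rightarrow> 'b::real_normed_vector"
  assumes "continuous_on U f" "open U"
  shows "open {x \<in> U. f x \<noteq> 0}"
proof -
  have "open (U \<inter> f -` (- {0}))"
    by (rule continuous_open_preimage[OF assms open_Compl[OF closed_singleton]])
  moreover have "U \<inter> f -` (- {0}) = {x \<in> U. f x \<noteq> 0}" by auto
  ultimately show ?thesis by simp
qed

lemma locally_constant_of_D_zero: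
  fixes f :: "'a::real_normed_vector \<Rightarrow> 'b::real_normed_vector"
  assumes "open A" "connected A" "smooth_on A f" "\<And>x v. x \<in> A \<Longrightarrow> D v f x = 0" "x \<in> A" "y \<in> A"
  shows "f x = f y"
proof (rule has_derivative_zero_unique_connected[OF assms(1,2) _ assms(5,6)])
  show "(f has_derivative (\<lambda>v. 0)) (at z)" if "z \<in> A" for z
    using smooth_on_has_derivative[OF assms(3) that] assms(4)[OF that] by simp
qed

text \<open>Hyperplanes (\<open>\<mu> = 0\<close>) and hyperspheres (\<open>\<mu> \<noteq> 0\<close>, centre \<open>- e / \<mu>\<close>) as level sets of one function, whose
  gradient is \<open>\<mu> x + e\<close>. The normalisation \<open>2 \<mu> k + e \<bullet> e = 1\<close> used throughout makes this gradient
  a unit normal on the quadric. Then \<open>\<mu>/2 |x|\<^sup>2 + k\<close> is the component of the position vector along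
  this normal.\<close>

definition quadric :: "real \<Rightarrow> 'a::real_inner \<Rightarrow> real \<Rightarrow> 'a set" where
  "quadric \<mu> e k = {x. \<mu> / 2 * (x \<bullet> x) + x \<bullet> e = k}"

lemma quadric_minus: "quadric (-\<mu>) (-e) (-k) = quadric \<mu> e k"
  unfolding quadric_def by (rule Collect_cong, simp) linarith

lemma quadric_unit_normal:
  assumes "x \<in> quadric \<mu> e k" "2 * \<mu> * k + e \<bullet> e = 1"
  shows "(\<mu> *\<^sub>R x + e) \<bullet> (\<mu> *\<^sub>R x + e) = 1"
proof -
  have "(\<mu> *\<^sub>R x + e) \<bullet> (\<mu> *\<^sub>R x + e) = 2 * \<mu> * (\<mu> / 2 * (x \<bullet> x) + x \<bullet> e) + e \<bullet> e"
    by (simp add: inner_add_left inner_add_right inner_commute algebra_simps)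
  then show ?thesis using assms unfolding quadric_def by simp
qed

section \<open>Umbilic patches\<close>

text \<open>The local content of the soliton equation: \<open>\<psi>\<close> parametrizes a hypersurface, \<open>Q\<close> is the normal part
  of the position vector, and the shape operator in the direction \<open>Q\<close> is \<open>-h\<close> times the identity.\<close>

locale umbilic_patch =
  fixes U :: "'c::euclidean_space set" and \<psi> Q :: "'c \<Rightarrow> 'a::euclidean_space" and h :: "'c \<Rightarrow> real"
  assumes open_U: "open U"
    and smooth_\<psi>: "smooth_on U \<psi>" and smooth_Q: "smooth_on U Q" and smooth_h: "smooth_on U h"
    and inj_D: "x \<in> U \<Longrightarrow> inj (\<lambda>a. D a \<psi> x)"
    and normal: "x \<in> U \<Longrightarrow> Q x \<bullet> D a \<psi> x = 0"
    and tangent: "x \<in> U \<Longrightarrow> \<exists>w. \<psi> x - Q x = D w \<psi> x"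
    and umbilic: "x \<in> U \<Longrightarrow> D a Q x \<bullet> D b \<psi> x = h x * (D a \<psi> x \<bullet> D b \<psi> x)"
    and codim_1: "DIM('a) = DIM('c) + 1" and dim_ge_2: "DIM('c) \<ge> 2"
begin

lemma linear_D\<psi>: "x \<in> U \<Longrightarrow> linear (\<lambda>a. D a \<psi> x)"
  by (rule smooth_on_linear_D[OF smooth_\<psi>])

lemma D\<psi>_eq_0_iff: "x \<in> U \<Longrightarrow> D a \<psi> x = 0 \<longleftrightarrow> a = 0"
  using linear_injective_0[OF linear_D\<psi>] inj_D linear_0[OF linear_D\<psi>] by blast

text \<open>In codimension one the tangent space and one nonzero normal vector span everything.\<close>

lemma eq_0_if_orthogonal:
  assumes x: "x \<in> U" and N: "N \<noteq> 0" "\<And>a. N \<bullet> D a \<psi> x = 0"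
    and y: "y \<bullet> N = 0" "\<And>a. y \<bullet> D a \<psi> x = 0"
  shows "y = 0"
proof -
  let ?V = "range (\<lambda>a. D a \<psi> x)"
  have V: "subspace ?V" using linear_subspace_image[OF linear_D\<psi>[OF x]] by simp
  have "dim ?V = DIM('c)"
    using dim_image_eq[OF linear_D\<psi>[OF x], of UNIV] inj_D[OF x] by simp
  moreover have "N \<notin> span ?V"
    unfolding span_eq_iff[THEN iffD2, OF V] using N by (metis imageE inner_eq_zero_iff)
  ultimately have "dim (insert N ?V) = DIM('a)"
    by (simp add: dim_insert codim_1)
  then have "y \<in> span (insert N ?V)" using dim_eq_full by blast
  moreover have "orthogonal y z" if "z \<in> insert N ?V" for z
    using that y by (auto simp: orthogonal_def)
  ultimately have "orthogonal y y" using orthogonal_to_span by blast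
  then show ?thesis by (simp add: orthogonal_def)
qed

lemma Q_inner_Q: "x \<in> U \<Longrightarrow> Q x \<bullet> Q x = \<psi> x \<bullet> Q x"
  using tangent[of x] normal[of x] by (metis eq_iff_diff_eq_0 inner_commute inner_diff_left)

text \<open>Half of the identity \<open>d|Q|\<^sup>2 = h d|\<psi>|\<^sup>2\<close>. It follows from differentiating \<open>|Q|\<^sup>2 = \<psi> \<bullet> Q\<close>, and it
  ties the zeros of \<open>Q\<close> to those of \<open>h\<close>.\<close>

lemma Q_inner_DQ:
  assumes x: "x \<in> U"
  shows "Q x \<bullet> D a Q x = h x * (\<psi> x \<bullet> D a \<psi> x)"
proof -
  obtain w where w: "\<psi> x - Q x = D w \<psi> x" using tangent[OF x] by blast
  have "D a (\<lambda>x. Q x \<bullet> Q x) x = D a (\<lambda>x. \<psi> x \<bullet> Q x) x"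
  proof (rule D_cong_open[OF open_U x Q_inner_Q])
    show "(\<lambda>x. Q x \<bullet> Q x) differentiable at x"
      using smooth_on_has_derivative[OF smooth_on_inner[OF open_U smooth_Q smooth_Q] x]
      by (rule differentiableI)
  qed
  then have "2 * (Q x \<bullet> D a Q x) = \<psi> x \<bullet> D a Q x"
    using normal[OF x, of a] unfolding D_inner[OF smooth_Q smooth_Q x] D_inner[OF smooth_\<psi> smooth_Q x]
    by (simp add: inner_commute)
  also have "\<psi> x = Q x + D w \<psi> x" by (simp flip: w)
  also have "(Q x + D w \<psi> x) \<bullet> D a Q x = Q x \<bullet> D a Q x + h x * (D w \<psi> x \<bullet> D a \<psi> x)"
    using umbilic[OF x, of a w]
    by (simp add: inner_add_left inner_commute[of "Q x" "D a Q x"] inner_commute[of "D w \<psi> x"])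
  also have "D w \<psi> x \<bullet> D a \<psi> x = \<psi> x \<bullet> D a \<psi> x"
    using normal[OF x, of a] unfolding w[symmetric] by (simp add: inner_diff_left)
  finally show ?thesis by simp
qed

text \<open>This is where the dimension has to be at least two: for \<open>a\<close>, \<open>b\<close> linearly independent the vectors
  \<open>D\<^sub>a \<psi>\<close>, \<open>D\<^sub>b \<psi>\<close> are independent, so both coefficients vanish.\<close>

lemma symmetric_product_form_zero:
  assumes "x \<in> U" "\<And>a b. c a *\<^sub>R D b \<psi> x = c b *\<^sub>R D a \<psi> x" and c: "linear c"
  shows "c a = (0::real)"
proof (cases "a = 0")
  case True
  then show ?thesis using linear_0[OF c] by simp
next
  case False
  have "dim {a} < DIM('c)" using dim_ge_2 dim_le_card[of "{a}" "{a}"] span_superset[of "{a}"] by simp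
  then have "span {a} \<noteq> UNIV" using dim_eq_full[of "{a}"] by auto
  then obtain b where b: "b \<notin> span {a}" by blast
  have "D (c a *\<^sub>R b - c b *\<^sub>R a) \<psi> x = 0"
    using assms(2)[of a b] linear_D\<psi>[OF assms(1)] by (simp add: linear_diff linear_scale)
  then have eq: "c a *\<^sub>R b = c b *\<^sub>R a" using D\<psi>_eq_0_iff[OF assms(1)] by simp
  show ?thesis
  proof (rule ccontr)
    assume "c a \<noteq> 0"
    then have "b = (c b / c a) *\<^sub>R a"
      using eq by (metis scaleR_scaleR divide_inverse mult.commute left_inverse scaleR_one)
    then show False using b by (metis singletonI span_base span_scale)
  qed
qed

text \<open>The umbilic theorem. The unit normal \<open>N\<close> satisfies \<open>D\<^sub>a N = \<mu> D\<^sub>a \<psi>\<close>; symmetry of \<open>D\<^sub>b D\<^sub>a N\<close> forces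
  \<open>d\<mu> = 0\<close>, and then \<open>N - \<mu> \<psi>\<close> and \<open>\<psi> \<bullet> N - \<mu>/2 |\<psi>|\<^sup>2\<close> have zero derivative as well.\<close>

lemma patch_in_quadric:
  assumes A: "open A" "connected A" "A \<subseteq> U" "A \<noteq> {}" and Q0: "\<forall>x\<in>A. Q x \<noteq> 0"
  obtains \<mu> e k where "2 * \<mu> * k + e \<bullet> e = 1"
    "\<forall>x\<in>A. h x = \<mu> * norm (Q x)"
    "\<forall>x\<in>A. Q x = norm (Q x) *\<^sub>R (\<mu> *\<^sub>R \<psi> x + e)"
    "\<forall>x\<in>A. norm (Q x) = \<mu> / 2 * (\<psi> x \<bullet> \<psi> x) + k"
    "\<psi> ` A \<subseteq> quadric \<mu> e k"
proof -
  note nz = bspec[OF Q0]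
  define N where "N x = inverse (norm (Q x)) *\<^sub>R Q x" for x
  define m where "m x = h x * inverse (norm (Q x))" for x
  note sA = smooth_on_subset[OF _ A(3)]
  have s\<psi>: "smooth_on A \<psi>" and sQ: "smooth_on A Q" and sh: "smooth_on A h"
    using smooth_\<psi> smooth_Q smooth_h sA by auto
  have sn: "smooth_on A (\<lambda>x. inverse (norm (Q x)))"
    using nz by (intro smooth_on_inverse[OF A(1)] smooth_on_norm[OF A(1)] sQ) auto
  have sN: "smooth_on A N" and sm: "smooth_on A m"
    unfolding N_def m_def by (intro smooth_on_scaleR smooth_on_mult A(1) sn sQ sh)+
  have N1: "N x \<bullet> N x = 1" if "x \<in> A" for x
    using nz[OF that] by (simp add: N_def dot_square_norm power2_eq_square)
  have N0: "N x \<noteq> 0" if "x \<in> A" for x using N1[OF that] by auto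
  have Ntan: "N x \<bullet> D a \<psi> x = 0" if "x \<in> A" for x a
    using normal[of x a] A(3) that by (auto simp: N_def)
  have DN: "D a N x = m x *\<^sub>R D a \<psi> x" if x: "x \<in> A" for x a
  proof -
    have xU: "x \<in> U" using A x by auto
    have "2 * (N x \<bullet> D a N x) = D a (\<lambda>x. N x \<bullet> N x) x"
      by (simp add: D_inner[OF sN sN x] inner_commute)
    also have "\<dots> = 0" by (rule D_const_on_open[OF A(1) x N1])
    finally have "N x \<bullet> D a N x = 0" by simp
    moreover have "D a N x \<bullet> D b \<psi> x = m x * (D a \<psi> x \<bullet> D b \<psi> x)" for b
      using umbilic[OF xU, of a b] normal[OF xU, of b]
      unfolding N_def m_def D_scaleR[OF sn sQ x] by (simp add: inner_add_left)
    ultimately have "D a N x - m x *\<^sub>R D a \<psi> x = 0"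
      using Ntan[OF x]
      by (intro eq_0_if_orthogonal[OF xU N0[OF x] Ntan[OF x]])
        (simp_all add: inner_diff_left inner_diff_right inner_commute[of _ "N x"])
    then show ?thesis by simp
  qed
  have DDN: "D b (D a N) x = m x *\<^sub>R D b (D a \<psi>) x + D b m x *\<^sub>R D a \<psi> x" if x: "x \<in> A" for x a b
  proof -
    have "D b (D a N) x = D b (\<lambda>x. m x *\<^sub>R D a \<psi> x) x"
      by (rule D_cong_open[OF A(1) x DN differentiableI[OF smooth_on_has_derivative[OF smooth_on_D[OF sN] x]]])
    then show ?thesis by (simp add: D_scaleR[OF sm smooth_on_D[OF s\<psi>] x])
  qed
  have Dm: "D a m x = 0" if x: "x \<in> A" for a x
  proof (rule symmetric_product_form_zero)
    show "x \<in> U" using A x by auto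
    show "D a m x *\<^sub>R D b \<psi> x = D b m x *\<^sub>R D a \<psi> x" for a b
      using D_commute[OF A(1) x sN, of a b] DDN[OF x, of a b] DDN[OF x, of b a]
        D_commute[OF A(1) x s\<psi>, of a b] by simp
  qed (rule smooth_on_linear_D[OF sm x])
  define E where "E x = N x - m x *\<^sub>R \<psi> x" for x
  define K where "K x = \<psi> x \<bullet> N x - m x * (\<psi> x \<bullet> \<psi> x) / 2" for x
  have sE: "smooth_on A E"
    unfolding E_def by (intro smooth_on_diff smooth_on_scaleR A(1) sN sm s\<psi>)
  have sK: "smooth_on A (\<lambda>x. \<psi> x \<bullet> N x - (m x * (1/2)) *\<^sub>R (\<psi> x \<bullet> \<psi> x))"
    by (intro smooth_on_diff smooth_on_scaleR smooth_on_mult smooth_on_inner smooth_on_const A(1) sN sm s\<psi>)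
  have Keq: "K = (\<lambda>x. \<psi> x \<bullet> N x - (m x * (1/2)) *\<^sub>R (\<psi> x \<bullet> \<psi> x))" by (simp add: K_def fun_eq_iff)
  have DE: "D a E x = 0" if x: "x \<in> A" for a x
    unfolding E_def
    by (simp add: D_diff[OF sN smooth_on_scaleR[OF A(1) sm s\<psi>] x] D_scaleR[OF sm s\<psi> x] Dm[OF x] DN[OF x])
  have DK: "D a K x = 0" if x: "x \<in> A" for a x
  proof -
    have sm2: "smooth_on A (\<lambda>x. m x * (1/2))" by (intro smooth_on_mult smooth_on_const A(1) sm)
    have "D a (\<lambda>x. m x * (1/2)) x = 0"
      using D_scaleR[OF sm smooth_on_const[of A "1/2::real"] x, of a] Dm[OF x] by simp
    moreover have "D a K x = D a (\<lambda>x. \<psi> x \<bullet> N x) x - D a (\<lambda>x. (m x * (1/2)) *\<^sub>R (\<psi> x \<bullet> \<psi> x)) x"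
      unfolding Keq
      by (rule D_diff[OF smooth_on_inner[OF A(1) s\<psi> sN]
            smooth_on_scaleR[OF A(1) sm2 smooth_on_inner[OF A(1) s\<psi> s\<psi>]] x])
    ultimately show ?thesis
      unfolding D_scaleR[OF sm2 smooth_on_inner[OF A(1) s\<psi> s\<psi>] x]
        D_inner[OF s\<psi> s\<psi> x] D_inner[OF s\<psi> sN x] DN[OF x]
      using Ntan[OF x, of a] by (simp add: inner_commute)
  qed
  obtain z where z: "z \<in> A" using A(4) by blast
  have const: "m x = m z" "E x = E z" "K x = K z" if "x \<in> A" for x
    using locally_constant_of_D_zero[OF A(1,2) sm Dm that z]
      locally_constant_of_D_zero[OF A(1,2) sE DE that z]
      locally_constant_of_D_zero[OF A(1,2) sK[folded Keq] DK that z] by auto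
  have NE: "N x = m z *\<^sub>R \<psi> x + E z" if "x \<in> A" for x
    using const[OF that] by (simp add: E_def diff_eq_eq ac_simps)
  have psiN: "\<psi> x \<bullet> N x = norm (Q x)" if "x \<in> A" for x
  proof -
    have "norm (Q x) * norm (Q x) = \<psi> x \<bullet> Q x"
      using Q_inner_Q[of x] A(3) that by (auto simp: dot_square_norm power2_eq_square)
    then show ?thesis using nz[OF that] by (simp add: N_def field_simps)
  qed
  have nQ: "norm (Q x) = m z / 2 * (\<psi> x \<bullet> \<psi> x) + K z" if "x \<in> A" for x
    using const(3)[OF that] psiN[OF that] const(1)[OF that] by (simp add: K_def)
  have quad: "\<psi> ` A \<subseteq> quadric (m z) (E z) (K z)"
  proof (clarsimp simp: quadric_def)
    fix x assume x: "x \<in> A"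
    have "m z * (\<psi> x \<bullet> \<psi> x) + \<psi> x \<bullet> E z = m z / 2 * (\<psi> x \<bullet> \<psi> x) + K z"
      using psiN[OF x] nQ[OF x] unfolding NE[OF x] by (simp add: inner_add_right)
    then show "m z * (\<psi> x \<bullet> \<psi> x) / 2 + \<psi> x \<bullet> E z = K z" by simp
  qed
  show ?thesis
  proof (rule that)
    have "1 = (m z *\<^sub>R \<psi> z + E z) \<bullet> (m z *\<^sub>R \<psi> z + E z)" using N1[OF z] NE[OF z] by simp
    also have "\<dots> = 2 * m z * (m z / 2 * (\<psi> z \<bullet> \<psi> z) + \<psi> z \<bullet> E z) + E z \<bullet> E z"
      by (simp add: inner_add_left inner_add_right inner_commute algebra_simps)
    also have "m z / 2 * (\<psi> z \<bullet> \<psi> z) + \<psi> z \<bullet> E z = K z"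
      using quad z by (auto simp: quadric_def)
    finally show "2 * m z * K z + E z \<bullet> E z = 1" by simp
    show "\<forall>x\<in>A. h x = m z * norm (Q x)"
    proof
      show "h x = m z * norm (Q x)" if "x \<in> A" for x
        using nz[OF that] const(1)[OF that, symmetric] by (simp add: m_def)
    qed
    show "\<forall>x\<in>A. Q x = norm (Q x) *\<^sub>R (m z *\<^sub>R \<psi> x + E z)"
    proof
      show "Q x = norm (Q x) *\<^sub>R (m z *\<^sub>R \<psi> x + E z)" if "x \<in> A" for x
        using NE[OF that, symmetric] nz[OF that] by (simp add: N_def)
    qed
  qed (use nQ quad in auto)
qed

text \<open>Conversely, on a patch of a quadric the data \<open>Q\<close>, \<open>h\<close> and their derivatives are explicit functions of
  \<open>\<psi>\<close>. These formulas hold regardless of zeros of \<open>Q\<close> and pass to limit points of the patch.\<close>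

lemma quadric_patch:
  assumes A: "open A" "A \<subseteq> U" and quad: "\<psi> ` A \<subseteq> quadric \<mu> e k" and unit: "2 * \<mu> * k + e \<bullet> e = 1"
    and x: "x \<in> A"
  shows "Q x = (\<mu> / 2 * (\<psi> x \<bullet> \<psi> x) + k) *\<^sub>R (\<mu> *\<^sub>R \<psi> x + e)"
    and "h x = (\<mu> / 2 * (\<psi> x \<bullet> \<psi> x) + k) * \<mu>"
    and "D a Q x = h x *\<^sub>R D a \<psi> x + (\<mu> * (\<psi> x \<bullet> D a \<psi> x)) *\<^sub>R (\<mu> *\<^sub>R \<psi> x + e)"
    and "D a h x = \<mu>\<^sup>2 * (\<psi> x \<bullet> D a \<psi> x)"
proof -
  define f where "f x = \<mu> / 2 * (\<psi> x \<bullet> \<psi> x) + k" for x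
  define \<nu> where "\<nu> x = \<mu> *\<^sub>R \<psi> x + e" for x
  have s\<psi>: "smooth_on A \<psi>" and sQ: "smooth_on A Q" and sh: "smooth_on A h"
    using smooth_\<psi> smooth_Q smooth_h A(2) smooth_on_subset by blast+
  have smu: "smooth_on A (\<lambda>x. \<mu> / 2 * (\<psi> x \<bullet> \<psi> x))"
    by (intro smooth_on_mult smooth_on_inner smooth_on_const A(1) s\<psi>)
  have sf: "smooth_on A f"
    unfolding f_def by (intro smooth_on_add smooth_on_const A(1) smu)
  have s\<nu>: "smooth_on A \<nu>"
    unfolding \<nu>_def by (intro smooth_on_add smooth_on_scaleR smooth_on_const A(1) s\<psi>)
  have Dq: "D a (\<lambda>x. \<mu> / 2 * (\<psi> x \<bullet> \<psi> x)) x = \<mu> * (\<psi> x \<bullet> D a \<psi> x)" if "x \<in> A" for x a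
    using D_scaleR[OF smooth_on_const[of A "\<mu>/2"] smooth_on_inner[OF A(1) s\<psi> s\<psi>] that, of a]
    by (simp add: D_inner[OF s\<psi> s\<psi> that] inner_commute)
  have Df: "D a f x = \<mu> * (\<psi> x \<bullet> D a \<psi> x)" if "x \<in> A" for x a
    unfolding f_def using D_add[OF smu smooth_on_const that, where v = a] Dq[OF that] by simp
  have D\<nu>: "D a \<nu> x = \<mu> *\<^sub>R D a \<psi> x" if "x \<in> A" for x a
    using D_add[OF smooth_on_scaleR[OF A(1) smooth_on_const s\<psi>] smooth_on_const that, where v = a]
      D_scaleR[OF smooth_on_const s\<psi> that, where v = a] by (simp add: \<nu>_def[abs_def])
  have \<nu>1: "\<nu> x \<bullet> \<nu> x = 1" if "x \<in> A" for x
    using quadric_unit_normal[OF _ unit] quad that by (auto simp: \<nu>_def)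
  have qx: "\<mu> / 2 * (\<psi> x \<bullet> \<psi> x) + \<psi> x \<bullet> e = k" if "x \<in> A" for x
    using quad that by (auto simp: quadric_def)
  have \<nu>tan: "\<nu> x \<bullet> D a \<psi> x = 0" if x: "x \<in> A" for x a
  proof -
    have "D a (\<lambda>x. \<mu> / 2 * (\<psi> x \<bullet> \<psi> x) + \<psi> x \<bullet> e) x = 0"
      by (rule D_const_on_open[OF A(1) x qx])
    then show ?thesis
      using D_add[OF smu smooth_on_inner[OF A(1) s\<psi> smooth_on_const] x, where v = a] Dq[OF x]
        D_inner_const[OF s\<psi> x, where v = a]
      by (simp add: \<nu>_def inner_add_left inner_commute[of e])
  qed
  have Qf: "Q x = f x *\<^sub>R \<nu> x" if x: "x \<in> A" for x
  proof -
    have xU: "x \<in> U" using A x by auto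
    obtain w where w: "\<psi> x - Q x = D w \<psi> x" using tangent[OF xU] by blast
    have "Q x \<bullet> \<nu> x = \<psi> x \<bullet> \<nu> x"
      using \<nu>tan[OF x, of w] unfolding w[symmetric] by (simp add: inner_diff_right inner_commute)
    also have "\<dots> = f x"
      using qx[OF x] by (simp add: \<nu>_def f_def inner_add_right)
    finally have "Q x - f x *\<^sub>R \<nu> x = 0"
      using \<nu>1[OF x] \<nu>tan[OF x] normal[OF xU]
      by (intro eq_0_if_orthogonal[OF xU _ \<nu>tan[OF x]]) (auto simp: inner_diff_left)
    then show ?thesis by simp
  qed
  have DQ: "D a Q x = f x *\<^sub>R (\<mu> *\<^sub>R D a \<psi> x) + (\<mu> * (\<psi> x \<bullet> D a \<psi> x)) *\<^sub>R \<nu> x" if x: "x \<in> A" for x a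
  proof -
    have "D a Q x = D a (\<lambda>x. f x *\<^sub>R \<nu> x) x"
      by (rule D_cong_open[OF A(1) x Qf differentiableI[OF smooth_on_has_derivative[OF sQ x]]])
    then show ?thesis by (simp add: D_scaleR[OF sf s\<nu> x] Df[OF x] D\<nu>[OF x])
  qed
  have hf: "h x = f x * \<mu>" if x: "x \<in> A" for x
  proof -
    have xU: "x \<in> U" using A x by auto
    obtain a :: 'c where "a \<noteq> 0" using nonzero_Basis SOME_Basis by blast
    then have pos: "D a \<psi> x \<bullet> D a \<psi> x \<noteq> 0" using D\<psi>_eq_0_iff[OF xU] by simp
    have "h x * (D a \<psi> x \<bullet> D a \<psi> x) = f x * \<mu> * (D a \<psi> x \<bullet> D a \<psi> x)"
      using umbilic[OF xU, of a a] \<nu>tan[OF x, of a] unfolding DQ[OF x] by (auto simp: inner_add_left)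
    then show ?thesis using pos mult_right_cancel by blast
  qed
  show "Q x = (\<mu> / 2 * (\<psi> x \<bullet> \<psi> x) + k) *\<^sub>R (\<mu> *\<^sub>R \<psi> x + e)" "h x = (\<mu> / 2 * (\<psi> x \<bullet> \<psi> x) + k) * \<mu>"
    using Qf[OF x] hf[OF x] by (simp_all add: f_def \<nu>_def)
  show "D a Q x = h x *\<^sub>R D a \<psi> x + (\<mu> * (\<psi> x \<bullet> D a \<psi> x)) *\<^sub>R (\<mu> *\<^sub>R \<psi> x + e)"
    using DQ[OF x] hf[OF x] by (simp add: \<nu>_def)
  have "D a h x = D a (\<lambda>x. f x *\<^sub>R \<mu>) x"
    using hf by (intro D_cong_open[OF A(1) x _ differentiableI[OF smooth_on_has_derivative[OF sh x]]]) auto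
  then show "D a h x = \<mu>\<^sup>2 * (\<psi> x \<bullet> D a \<psi> x)"
    using D_scaleR[OF sf smooth_on_const[of A \<mu>] x, where v = a] Df[OF x] by (simp add: power2_eq_square)
qed

section \<open>Continuation of a quadric across the patch\<close>

text \<open>A ball around \<open>p\<close> without zeros of \<open>Q\<close> lies in some quadric. Comparing the data at one
  common point with the given patch identifies the two quadrics, up to the sign \<open>s\<close> that accounts for
  \<open>Q\<close> and the gradient \<open>\<mu> x + e\<close> pointing to opposite sides.\<close>

lemma extends_near_nonzero_normal:
  assumes A: "open A" "A \<subseteq> U" and quad: "\<psi> ` A \<subseteq> quadric \<mu> e k" and unit: "2 * \<mu> * k + e \<bullet> e = 1"
    and p: "p \<in> U" "p \<in> closure A" and Qp: "Q p \<noteq> 0"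
  shows "\<exists>\<epsilon>>0. ball p \<epsilon> \<subseteq> U \<and> \<psi> ` ball p \<epsilon> \<subseteq> quadric \<mu> e k"
proof -
  have "open {x \<in> U. Q x \<noteq> 0}"
    by (rule open_nonzero[OF smooth_on_continuous_on[OF smooth_Q] open_U])
  then obtain \<epsilon> where \<epsilon>: "\<epsilon> > 0" "ball p \<epsilon> \<subseteq> {x \<in> U. Q x \<noteq> 0}"
    using p(1) Qp unfolding open_contains_ball by blast
  have "ball p \<epsilon> \<subseteq> U" "ball p \<epsilon> \<noteq> {}" "\<forall>x\<in>ball p \<epsilon>. Q x \<noteq> 0" using \<epsilon> by auto
  then obtain \<mu>' e' k' where "2 * \<mu>' * k' + e' \<bullet> e' = 1" and 1:
    "\<forall>x\<in>ball p \<epsilon>. h x = \<mu>' * norm (Q x)"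
    "\<forall>x\<in>ball p \<epsilon>. Q x = norm (Q x) *\<^sub>R (\<mu>' *\<^sub>R \<psi> x + e')"
    "\<forall>x\<in>ball p \<epsilon>. norm (Q x) = \<mu>' / 2 * (\<psi> x \<bullet> \<psi> x) + k'"
    "\<psi> ` ball p \<epsilon> \<subseteq> quadric \<mu>' e' k'"
    by (rule patch_in_quadric[OF open_ball connected_ball]) (rule that)
  obtain z where z: "z \<in> A" "z \<in> ball p \<epsilon>"
    using p(2) \<epsilon>(1) unfolding closure_approachable by (auto simp: dist_commute)
  define f where "f = \<mu> / 2 * (\<psi> z \<bullet> \<psi> z) + k"
  define \<nu> where "\<nu> = \<mu> *\<^sub>R \<psi> z + e"
  have \<nu>1: "norm \<nu> = 1"
    using quadric_unit_normal[OF _ unit, of "\<psi> z"] quad z(1) by (auto simp: \<nu>_def norm_eq_1)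
  have Qz: "Q z = f *\<^sub>R \<nu>" and hz: "h z = f * \<mu>"
    using quadric_patch(1,2)[OF A quad unit z(1)] by (simp_all add: f_def \<nu>_def)
  have nQ: "norm (Q z) = \<bar>f\<bar>" using Qz \<nu>1 by simp
  have f0: "f \<noteq> 0" using Qz \<epsilon>(2) z(2) by auto
  define s where "s = sgn f"
  have fs: "\<bar>f\<bar> * s = f" and sf: "s * f = \<bar>f\<bar>" and ss: "s = 1 \<or> s = -1"
    using f0 unfolding s_def by (auto simp: sgn_if)
  have \<mu>': "\<mu>' = s * \<mu>"
  proof -
    have "\<bar>f\<bar> * \<mu>' = \<bar>f\<bar> * (s * \<mu>)"
      using bspec[OF 1(1) z(2)] unfolding hz nQ mult.assoc[symmetric] fs by (simp add: mult.commute)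
    then show ?thesis using f0 by simp
  qed
  have "\<bar>f\<bar> *\<^sub>R (\<mu>' *\<^sub>R \<psi> z + e') = f *\<^sub>R \<nu>"
    by (rule trans[OF bspec[OF 1(2) z(2), unfolded nQ, symmetric] Qz])
  also have "\<dots> = \<bar>f\<bar> *\<^sub>R (s *\<^sub>R \<nu>)" by (simp add: fs)
  finally have "\<mu>' *\<^sub>R \<psi> z + e' = s *\<^sub>R \<nu>" using f0 unfolding scaleR_cancel_left by simp
  then have e': "e' = s *\<^sub>R e" by (simp add: \<nu>_def \<mu>' scaleR_add_right)
  have "k' = s * f - \<mu>' / 2 * (\<psi> z \<bullet> \<psi> z)"
    using bspec[OF 1(3) z(2), unfolded nQ, folded sf] by linarith
  also have "\<dots> = s * k" unfolding f_def \<mu>' by (simp add: algebra_simps)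
  finally have k': "k' = s * k" .
  have "quadric \<mu>' e' k' = quadric \<mu> e k"
    unfolding \<mu>' e' k' using ss by (elim disjE) (simp_all add: quadric_minus)
  then have "ball p \<epsilon> \<subseteq> U \<and> \<psi> ` ball p \<epsilon> \<subseteq> quadric \<mu> e k" using \<epsilon>(2) 1(4) by blast
  then show ?thesis using \<epsilon>(1) by blast
qed

text \<open>The zeros of \<open>Q\<close> are nowhere dense near \<open>p\<close>, and off them every small ball lies in a quadric
  with its own \<open>\<mu>'\<close>, \<open>e'\<close>. The functions \<open>m\<close> and \<open>R\<close> below recover \<open>\<mu>'\<^sup>2\<close> and \<open>\<mu>' e'\<close> from first derivatives
  and are smooth across the zeros of \<open>Q\<close>, so their derivatives vanish by density and they
  keep the values that they have on the given patch. Since \<open>|\<mu>' (\<mu>' x + e')|\<^sup>2 = \<mu>'\<^sup>2\<close>, these values put the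
  whole ball into the given quadric.\<close>

lemma extends_near_zero_normal:
  assumes A: "open A" "A \<subseteq> U" and quad: "\<psi> ` A \<subseteq> quadric \<mu> e k" and unit: "2 * \<mu> * k + e \<bullet> e = 1"
    and nondeg: "\<mu> \<noteq> 0 \<or> k \<noteq> 0"
    and p: "p \<in> U" "p \<in> closure A" and Qp: "Q p = 0" and \<psi>p: "\<psi> p \<noteq> 0"
  shows "\<exists>\<epsilon>>0. ball p \<epsilon> \<subseteq> U \<and> \<psi> ` ball p \<epsilon> \<subseteq> quadric \<mu> e k"
proof -
  note sD = smooth_on_D[OF smooth_\<psi>]
  note cont = smooth_on_continuous_on
  note lim = eq_on_closure[OF open_U _ _ A(2) _ p(2,1), where 'b = 'a]
  note lim_real = eq_on_closure[OF open_U _ _ A(2) _ p(2,1), where 'b = real]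
  note c\<psi> = cont[OF smooth_\<psi>]
  obtain a where "\<psi> p - Q p = D a \<psi> p" using tangent[OF p(1)] by blast
  then have a: "D a \<psi> p = \<psi> p" using Qp by simp
  have "\<mu> / 2 * (\<psi> p \<bullet> \<psi> p) + \<psi> p \<bullet> e = k"
  proof (rule lim_real)
    show "continuous_on U (\<lambda>x. \<mu> / 2 * (\<psi> x \<bullet> \<psi> x) + \<psi> x \<bullet> e)" by (intro continuous_intros c\<psi>)
    show "\<mu> / 2 * (\<psi> x \<bullet> \<psi> x) + \<psi> x \<bullet> e = k" if "x \<in> A" for x
      using quad that by (auto simp: quadric_def)
  qed simp
  then have \<psi>pq: "\<psi> p \<in> quadric \<mu> e k" by (simp add: quadric_def)
  have "Q p = (\<mu> / 2 * (\<psi> p \<bullet> \<psi> p) + k) *\<^sub>R (\<mu> *\<^sub>R \<psi> p + e)"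
  proof (rule lim[OF cont[OF smooth_Q] _ quadric_patch(1)[OF A quad unit]])
    show "continuous_on U (\<lambda>x. (\<mu> / 2 * (\<psi> x \<bullet> \<psi> x) + k) *\<^sub>R (\<mu> *\<^sub>R \<psi> x + e))"
      by (intro continuous_intros c\<psi>)
  qed
  then have "\<mu> / 2 * (\<psi> p \<bullet> \<psi> p) + k = 0"
    using Qp quadric_unit_normal[OF \<psi>pq unit] by auto
  then have \<mu>: "\<mu> \<noteq> 0" using nondeg by auto
  \<comment> \<open>The direction a is chosen so that the right hand side is the nonzero number \<open>\<mu>\<^sup>2 |\<psi> p|\<^sup>2\<close>.\<close>
  have "D a h p = \<mu>\<^sup>2 * (\<psi> p \<bullet> D a \<psi> p)"
  proof (rule lim_real[OF cont[OF smooth_on_D[OF smooth_h]] _ quadric_patch(4)[OF A quad unit]])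
    show "continuous_on U (\<lambda>x. \<mu>\<^sup>2 * (\<psi> x \<bullet> D a \<psi> x))"
      by (intro continuous_on_mult continuous_on_inner continuous_on_const c\<psi> cont[OF sD])
  qed
  then have Dhp: "D a h p \<noteq> 0" using \<mu> \<psi>p by (simp add: a)
  define w where "w x = \<psi> x \<bullet> D a \<psi> x" for x
  have wp: "w p \<noteq> 0" using \<psi>p by (simp add: w_def a)
  have sw: "smooth_on U w" unfolding w_def by (intro smooth_on_inner open_U smooth_\<psi> sD)
  have "open ({x \<in> U. w x \<noteq> 0} \<inter> {x \<in> U. D a h x \<noteq> 0})" (is "open ?G")
    by (intro open_Int open_nonzero cont sw smooth_on_D smooth_h open_U)
  moreover have "p \<in> ?G" using p(1) wp Dhp by simp
  ultimately obtain \<epsilon> where \<epsilon>: "\<epsilon> > 0" "ball p \<epsilon> \<subseteq> ?G"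
    by (rule openE)
  define B where "B = ball p \<epsilon>"
  have B: "open B" "connected B" "B \<subseteq> U" "p \<in> B" and wB: "\<And>x. x \<in> B \<Longrightarrow> w x \<noteq> 0"
    and DhB: "\<And>x. x \<in> B \<Longrightarrow> D a h x \<noteq> 0"
    using \<epsilon> by (auto simp: B_def)
  define W where "W = {x \<in> B. Q x \<noteq> 0}"
  have sB: "smooth_on B \<psi>" "smooth_on B Q" "smooth_on B h" "smooth_on B w"
    using smooth_\<psi> smooth_Q smooth_h sw B(3) smooth_on_subset by blast+
  have W: "open W" "W \<subseteq> B"
    unfolding W_def by (rule open_nonzero[OF cont[OF sB(2)] B(1)]) auto
  \<comment> \<open>On an open set of zeros of Q the function h would vanish identically, against \<open>D a h \<noteq> 0\<close>.\<close>
  have dense: "x \<in> closure W" if x: "x \<in> B" for x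
  proof (rule ccontr)
    assume "x \<notin> closure W"
    then have xC: "x \<in> B - closure W" using x by simp
    have C: "open (B - closure W)" using B(1) by (simp add: open_Diff)
    have "h y = 0" if y: "y \<in> B - closure W" for y
    proof -
      have "Q y = 0" using y closure_subset[of W] by (auto simp: W_def)
      then have "h y * w y = 0" using Q_inner_DQ[of y a] y B(3) by (auto simp: w_def)
      then show ?thesis using wB[of y] y by simp
    qed
    then have "D a h x = 0" by (rule D_const_on_open[OF C xC])
    then show False using DhB[OF x] by simp
  qed
  define m where "m x = D a h x / w x" for x
  define R where "R x = (1 / w x) *\<^sub>R (D a Q x - h x *\<^sub>R D a \<psi> x) - m x *\<^sub>R \<psi> x" for x
  have sm: "smooth_on B m"
    unfolding m_def by (intro smooth_on_divide B(1) smooth_on_D sB wB)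
  have sR: "smooth_on B R"
    unfolding R_def
    by (intro smooth_on_diff smooth_on_scaleR smooth_on_divide smooth_on_const B(1) smooth_on_D sB sm wB)
  have form: "m x = \<mu>'\<^sup>2" "R x = \<mu>' *\<^sub>R e'" "(norm (R x + m x *\<^sub>R \<psi> x))\<^sup>2 = m x"
    if "open A'" "A' \<subseteq> B" "\<psi> ` A' \<subseteq> quadric \<mu>' e' k'" "2 * \<mu>' * k' + e' \<bullet> e' = 1" "x \<in> A'"
    for A' \<mu>' e' k' x
  proof -
    have A'U: "A' \<subseteq> U" and wx: "w x \<noteq> 0" using that B(3) wB by auto
    note q = quadric_patch[OF that(1) A'U that(3-5)]
    show m: "m x = \<mu>'\<^sup>2" using q(4)[of a] wx by (simp add: m_def w_def)
    have "D a Q x - h x *\<^sub>R D a \<psi> x = w x *\<^sub>R \<mu>' *\<^sub>R (\<mu>' *\<^sub>R \<psi> x + e')"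
      using q(3)[of a] by (simp add: w_def mult.commute)
    then show R: "R x = \<mu>' *\<^sub>R e'"
      using wx by (simp add: R_def m scaleR_add_right power2_eq_square)
    have "R x + m x *\<^sub>R \<psi> x = \<mu>' *\<^sub>R (\<mu>' *\<^sub>R \<psi> x + e')"
      by (simp add: R m scaleR_add_right power2_eq_square)
    moreover have "norm (\<mu>' *\<^sub>R \<psi> x + e') = 1"
      using quadric_unit_normal[OF _ that(4), of "\<psi> x"] that(3,5) by (auto simp: norm_eq_1)
    ultimately show "(norm (R x + m x *\<^sub>R \<psi> x))\<^sup>2 = m x" by (simp add: m)
  qed
  have onW: "D b m x = 0" "D b R x = 0" "(norm (R x + m x *\<^sub>R \<psi> x))\<^sup>2 = m x" if x: "x \<in> W" for x b
  proof -
    obtain \<delta> where \<delta>: "\<delta> > 0" "ball x \<delta> \<subseteq> W" using W(1) x unfolding open_contains_ball by blast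
    have "ball x \<delta> \<subseteq> U" "ball x \<delta> \<noteq> {}" "\<forall>y\<in>ball x \<delta>. Q y \<noteq> 0"
      using \<delta> W(2) B(3) by (auto simp: W_def)
    then obtain \<mu>' e' k' where 1: "2 * \<mu>' * k' + e' \<bullet> e' = 1"
      "\<forall>x\<in>ball x \<delta>. h x = \<mu>' * norm (Q x)"
      "\<forall>x\<in>ball x \<delta>. Q x = norm (Q x) *\<^sub>R (\<mu>' *\<^sub>R \<psi> x + e')"
      "\<forall>x\<in>ball x \<delta>. norm (Q x) = \<mu>' / 2 * (\<psi> x \<bullet> \<psi> x) + k'"
      "\<psi> ` ball x \<delta> \<subseteq> quadric \<mu>' e' k'"
      by (rule patch_in_quadric[OF open_ball connected_ball]) (rule that)
    have 2: "2 * \<mu>' * k' + e' \<bullet> e' = 1" "x \<in> ball x \<delta>" "ball x \<delta> \<subseteq> B" using 1(1) \<delta> W(2) by auto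
    note f = form[OF open_ball 2(3) 1(5) 2(1)]
    show "D b m x = 0" "D b R x = 0"
      using D_const_on_open[OF open_ball 2(2) f(1)] D_const_on_open[OF open_ball 2(2) f(2)] by auto
    show "(norm (R x + m x *\<^sub>R \<psi> x))\<^sup>2 = m x" using f(3)[OF 2(2)] .
  qed
  have DB: "D b m x = 0" "D b R x = 0" if "x \<in> B" for b x
    using eq_on_closure[OF B(1) cont[OF smooth_on_D[OF sm]] continuous_on_const W(2) onW(1) dense[OF that] that]
      eq_on_closure[OF B(1) cont[OF smooth_on_D[OF sR]] continuous_on_const W(2) onW(2) dense[OF that] that]
    by blast+
  have norm_eq: "(norm (R x + m x *\<^sub>R \<psi> x))\<^sup>2 = m x" if "x \<in> B" for x
  proof (rule eq_on_closure[OF B(1) _ cont[OF sm] W(2) onW(3) dense[OF that] that])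
    show "continuous_on B (\<lambda>x. (norm (R x + m x *\<^sub>R \<psi> x))\<^sup>2)"
      by (intro continuous_intros cont sR sm sB(1))
  qed
  obtain z where z: "z \<in> A \<inter> B"
    using p(2) B(1,4) open_Int_closure_eq_empty[OF B(1), of A] by blast
  have AB: "open (A \<inter> B)" "\<psi> ` (A \<inter> B) \<subseteq> quadric \<mu> e k" "A \<inter> B \<subseteq> B" using A(1) B(1) quad by auto
  have "\<psi> x \<in> quadric \<mu> e k" if x: "x \<in> B" for x
  proof -
    have "m x = \<mu>\<^sup>2" "R x = \<mu> *\<^sub>R e"
      using form(1,2)[OF AB(1,3,2) unit z] z x
        locally_constant_of_D_zero[OF B(1,2) sm DB(1) x, of z]
        locally_constant_of_D_zero[OF B(1,2) sR DB(2) x, of z] by auto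
    then have "(norm (\<mu> *\<^sub>R e + \<mu>\<^sup>2 *\<^sub>R \<psi> x))\<^sup>2 = \<mu>\<^sup>2" using norm_eq[OF x] by simp
    moreover have "\<mu> *\<^sub>R e + \<mu>\<^sup>2 *\<^sub>R \<psi> x = \<mu> *\<^sub>R (\<mu> *\<^sub>R \<psi> x + e)"
      by (simp add: scaleR_add_right power2_eq_square)
    ultimately have "(norm (\<mu> *\<^sub>R \<psi> x + e))\<^sup>2 = 1"
      using \<mu> by (simp add: power_mult_distrib)
    then have "2 * \<mu> * (\<mu> / 2 * (\<psi> x \<bullet> \<psi> x) + \<psi> x \<bullet> e) + e \<bullet> e = 2 * \<mu> * k + e \<bullet> e"
      unfolding unit power2_norm_eq_inner
      by (simp add: inner_add_left inner_add_right inner_commute algebra_simps)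
    then show ?thesis using \<mu> by (simp add: quadric_def)
  qed
  then have "ball p \<epsilon> \<subseteq> U \<and> \<psi> ` ball p \<epsilon> \<subseteq> quadric \<mu> e k" using B(3) unfolding B_def by blast
  then show ?thesis using \<epsilon>(1) by blast
qed

text \<open>The interior of the set of parameters mapped into the quadric is closed relative to \<open>U\<close> minus the
  preimage of the origin. That preimage is at most a point, whose removal keeps \<open>U\<close> connected; the
  origin itself is recovered by continuity. The condition \<open>\<mu> \<noteq> 0 \<or> k \<noteq> 0\<close> excludes a hyperplane
  through the origin, along which \<open>Q = 0\<close> and which a cone that is not flat may continue smoothly.\<close>

lemma connected_patch_in_quadric:
  assumes U: "connected U" "inj_on \<psi> U"
    and A: "open A" "A \<subseteq> U" "A \<noteq> {}" and quad: "\<psi> ` A \<subseteq> quadric \<mu> e k"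
    and unit: "2 * \<mu> * k + e \<bullet> e = 1" and nondeg: "\<mu> \<noteq> 0 \<or> k \<noteq> 0"
  shows "\<psi> ` U \<subseteq> quadric \<mu> e k"
proof -
  define E where "E = interior {x \<in> U. \<psi> x \<in> quadric \<mu> e k}"
  define Z where "Z = {x \<in> U. \<psi> x = 0}"
  have Z: "finite Z" "Z \<subseteq> U"
  proof -
    have "\<psi> ` Z \<subseteq> {0}" "inj_on \<psi> Z" using U(2) by (auto simp: Z_def inj_on_def)
    then show "finite Z" using finite_subset[of "\<psi> ` Z" "{0}"] finite_imageD by auto
  qed (simp add: Z_def)
  have U': "connected (U - Z)"
    by (rule connected_open_delete_finite[OF open_U U(1) _ Z(1)]) (use dim_ge_2 in simp)
  have E: "open E" "E \<subseteq> U" "\<psi> ` E \<subseteq> quadric \<mu> e k"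
    using interior_subset[of "{x \<in> U. \<psi> x \<in> quadric \<mu> e k}"] by (auto simp: E_def)
  have "A \<subseteq> E" unfolding E_def using A quad by (intro interior_maximal) auto
  have clos: "p \<in> E" if "p \<in> U - Z" "p \<in> closure E" for p
  proof -
    have "\<exists>\<epsilon>>0. ball p \<epsilon> \<subseteq> U \<and> \<psi> ` ball p \<epsilon> \<subseteq> quadric \<mu> e k"
      using extends_near_nonzero_normal[OF E unit] extends_near_zero_normal[OF E unit nondeg] that
      by (cases "Q p = 0") (auto simp: Z_def)
    then obtain \<epsilon> where "\<epsilon> > 0" "ball p \<epsilon> \<subseteq> {x \<in> U. \<psi> x \<in> quadric \<mu> e k}" by auto
    then show ?thesis unfolding E_def by (meson interior_maximal open_ball centre_in_ball subsetD)
  qed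
  have "E \<inter> (U - Z) \<noteq> {}"
  proof
    assume "E \<inter> (U - Z) = {}"
    then have "E \<subseteq> Z" using E(2) by auto
    then have "finite E" using Z(1) finite_subset by blast
    then have "E = {}" using E(1) finite_imp_not_open by blast
    then show False using A(3) \<open>A \<subseteq> E\<close> by blast
  qed
  then have "- closure E \<inter> (U - Z) = {}"
    using connectedD[OF U' E(1), of "- closure E"] clos closure_subset[of E] by auto
  then have "U - Z \<subseteq> E" using clos by auto
  moreover have "Z \<subseteq> closure E"
  proof
    fix z assume z: "z \<in> Z"
    then have "z islimpt U" using Z(2) open_U interior_limit_point[of z U] interior_open by auto
    then have "z islimpt (U - Z)" using islimpt_Un_finite[OF Z(1), of z "U - Z"] Z(2) by (simp add: Un_absorb1)
    then show "z \<in> closure E" using \<open>U - Z \<subseteq> E\<close> islimpt_subset unfolding closure_def by blast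
  qed
  ultimately have UE: "U \<subseteq> closure E" using closure_subset by blast
  show ?thesis
  proof (clarsimp simp: quadric_def)
    fix x assume x: "x \<in> U"
    have "\<mu> / 2 * (\<psi> x \<bullet> \<psi> x) + \<psi> x \<bullet> e = k"
    proof (rule eq_on_closure[OF open_U _ continuous_on_const E(2) _ _ x])
      show "continuous_on U (\<lambda>x. \<mu> / 2 * (\<psi> x \<bullet> \<psi> x) + \<psi> x \<bullet> e)"
        by (intro continuous_intros smooth_on_continuous_on[OF smooth_\<psi>])
      show "\<mu> / 2 * (\<psi> y \<bullet> \<psi> y) + \<psi> y \<bullet> e = k" if "y \<in> E" for y
        using E(3) that by (auto simp: quadric_def)
      show "x \<in> closure E" using UE x by blast
    qed
    then show "\<mu> * (\<psi> x \<bullet> \<psi> x) / 2 + \<psi> x \<bullet> e = k" by simp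
  qed
qed

end

section \<open>Tangent spaces in a chart\<close>

lemma local_parametrizationD:
  assumes "local_parametrization M U \<psi>"
  shows "open U" "smooth_on U \<psi>" "\<And>u. u \<in> U \<Longrightarrow> inj (\<lambda>a. D a \<psi> u)"
    "openin (top_of_set M) (\<psi> ` U)" "\<psi> ` U \<subseteq> M" "inj_on \<psi> U"
    and "\<And>B. open B \<Longrightarrow> B \<subseteq> U \<Longrightarrow> openin (top_of_set M) (\<psi> ` B)"
proof -
  show U: "open U" "smooth_on U \<psi>" "\<And>u. u \<in> U \<Longrightarrow> inj (\<lambda>a. D a \<psi> u)"
    and o: "openin (top_of_set M) (\<psi> ` U)"
    using assms unfolding local_parametrization_def by blast+
  obtain \<eta> where \<eta>: "homeomorphism U (\<psi> ` U) \<psi> \<eta>"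
    using assms unfolding local_parametrization_def by blast
  show "\<psi> ` U \<subseteq> M" using o by (rule openin_imp_subset)
  show "inj_on \<psi> U" 
    by (rule inj_on_inverseI[of U \<eta>]) (use \<eta> in \<open>simp add: homeomorphism_def\<close>)
  show "openin (top_of_set M) (\<psi> ` B)" if "open B" "B \<subseteq> U" for B
  proof -
    have "openin (top_of_set U) B" using that U(1) by (simp add: openin_open_eq)
    then show ?thesis by (rule openin_trans[OF homeomorphism_imp_open_map[OF \<eta>] o])
  qed
qed

lemma mem_range_if_orthogonal:
  fixes L :: "'b::real_vector \<Rightarrow> 'a::euclidean_space"
  assumes L: "linear L" and orth: "\<And>z. (\<And>a. z \<bullet> L a = 0) \<Longrightarrow> z \<bullet> w = 0"
  shows "w \<in> range L"
proof -
  have V: "span (range L) = range L"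
    using linear_subspace_image[OF L subspace_UNIV] span_eq_iff by blast
  obtain y z where yz: "y \<in> span (range L)" "\<And>x. x \<in> span (range L) \<Longrightarrow> orthogonal z x" "w = y + z"
    using orthogonal_subspace_decomp_exists by metis
  have "z \<bullet> L a = 0" for a using yz(2) V by (auto simp: orthogonal_def)
  then have "z \<bullet> w = 0" by (rule orth)
  moreover have "z \<bullet> y = 0" using yz(1,2) by (auto simp: orthogonal_def)
  ultimately have "z = 0" by (simp add: yz(3) inner_add_right)
  then show ?thesis using yz V by simp
qed

text \<open>The nontrivial inclusion: a curve \<open>c\<close> in \<open>M\<close> through \<open>\<psi> u\<close> is \<open>\<psi> \<circ> \<gamma>\<close> near \<open>0\<close> with \<open>\<gamma>\<close> merely known to be
  continuous. Injectivity of the derivative \<open>L\<close> of \<open>\<psi>\<close> at \<open>u\<close> gives \<open>|\<gamma> t - u| = O(|c t - c 0|) = O(t)\<close>, so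
  against a vector \<open>z\<close> orthogonal to the range of \<open>L\<close> the difference quotient of \<open>c\<close> is \<open>o(1)\<close>.\<close>

lemma tangent_space_parametrization:
  fixes \<psi> :: "real^'n \<Rightarrow> 'a::euclidean_space"
  assumes lp: "local_parametrization M U \<psi>" and u: "u \<in> U"
  shows "tangent_space M (\<psi> u) = range (\<lambda>a. D a \<psi> u)"
proof
  note P = local_parametrizationD[OF lp]
  note d\<psi> = smooth_on_has_derivative[OF P(2) u]
  show "range (\<lambda>a. D a \<psi> u) \<subseteq> tangent_space M (\<psi> u)"
  proof clarify
    fix a :: "real^'n"
    obtain r where r: "r > 0" "ball u r \<subseteq> U" using P(1) u unfolding open_contains_ball by blast
    define e where "e = r / (norm a + 1)"
    have na: "norm a + 1 > 0" by (simp add: add_nonneg_pos)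
    have e: "e > 0" using r na by (simp add: e_def)
    have inU: "u + t *\<^sub>R a \<in> U" if "t \<in> {-e<..<e}" for t
    proof -
      have "\<bar>t\<bar> * norm a \<le> \<bar>t\<bar> * (norm a + 1)" by (simp add: mult_left_mono)
      also have "\<dots> < e * (norm a + 1)" using that na by (intro mult_strict_right_mono) auto
      also have "\<dots> = r" using na unfolding e_def by (simp add: divide_simps)
      finally show ?thesis using r(2) by (auto simp: dist_norm)
    qed
    have lin: "((\<lambda>t. u + t *\<^sub>R a) has_derivative (\<lambda>t. t *\<^sub>R a)) (at 0)"
      by (auto intro!: derivative_eq_intros)
    have "((\<lambda>t. \<psi> (u + t *\<^sub>R a)) has_derivative (\<lambda>t. D (t *\<^sub>R a) \<psi> u)) (at 0)"
      using has_derivative_compose[OF lin] d\<psi> by simp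
    then have "((\<lambda>t. \<psi> (u + t *\<^sub>R a)) has_vector_derivative D a \<psi> u) (at 0)"
      unfolding has_vector_derivative_def
      by (simp add: linear_scale[OF smooth_on_linear_D[OF P(2) u]])
    then show "D a \<psi> u \<in> tangent_space M (\<psi> u)"
      unfolding tangent_space_def
      using e inU P(5) smooth_on_compose_line[OF P(2) open_greaterThanLessThan inU]
      by (intro CollectI exI[of _ "\<lambda>t. \<psi> (u + t *\<^sub>R a)"] exI[of _ e]) auto
  qed
  show "tangent_space M (\<psi> u) \<subseteq> range (\<lambda>a. D a \<psi> u)"
  proof
    fix w assume "w \<in> tangent_space M (\<psi> u)"
    then obtain c e where c: "e > 0" "c ` {-e<..<e} \<subseteq> M" "c 0 = \<psi> u"
      and dc: "(c has_vector_derivative w) (at (0::real))"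
      unfolding tangent_space_def by blast
    define L where "L = (\<lambda>a. D a \<psi> u)"
    have L: "linear L" "inj L" using smooth_on_linear_D[OF P(2) u] P(3)[OF u] by (simp_all add: L_def)
    obtain b where b: "b > 0" "\<And>x. b * norm x \<le> norm (L x)"
      using linear_inj_bounded_below_pos[OF L] by blast
    obtain \<eta> where \<eta>: "homeomorphism U (\<psi> ` U) \<psi> \<eta>" using lp by (auto simp: local_parametrization_def)
    obtain O' where O': "open O'" "\<psi> ` U = M \<inter> O'" using P(4) by (auto simp: openin_open)
    have cont_c: "(c \<longlongrightarrow> \<psi> u) (at 0)"
      using has_vector_derivative_continuous[OF dc] c(3) by (simp add: continuous_at)
    have in_e: "\<forall>\<^sub>F t in at 0. t \<in> {-e<..<e}"
      using c(1) by (intro eventually_at_in_open') auto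
    have "\<forall>\<^sub>F t in at 0. c t \<in> O'"
      using O' u by (intro topological_tendstoD[OF cont_c]) blast+
    with in_e have in_U: "\<forall>\<^sub>F t in at 0. c t \<in> \<psi> ` U"
      unfolding O'(2) by eventually_elim (use c(2) in blast)
    have \<gamma>: "((\<lambda>t. \<eta> (c t)) \<longlongrightarrow> u) (at 0)"
    proof -
      have "continuous_on (\<psi> ` U) \<eta>" "\<eta> (\<psi> u) = u" using \<eta> u by (auto simp: homeomorphism_def)
      then show ?thesis
        using continuous_on_tendsto_compose[OF _ cont_c _ in_U, of \<eta>] imageI[OF u, of \<psi>] by simp
    qed
    have quot: "\<forall>\<^sub>F t in at 0. norm (c t - \<psi> u) \<le> (norm w + 1) * \<bar>t\<bar>"
    proof -
      have "\<forall>e>0. \<exists>d>0. \<forall>t. norm (t - 0) < d \<longrightarrow> norm (c t - c 0 - (t - 0) *\<^sub>R w) \<le> e * norm (t - 0)"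
        using dc unfolding has_vector_derivative_def has_derivative_at_alt by (rule conjunct2)
      from mp[OF spec[OF this, of 1] zero_less_one]
      obtain d where "d > 0 \<and>
        (\<forall>t. norm (t - 0) < d \<longrightarrow> norm (c t - c 0 - (t - 0) *\<^sub>R w) \<le> 1 * norm (t - 0))" ..
      note d = conjunct1[OF this] conjunct2[OF this]
      have "norm (c t - \<psi> u) \<le> (norm w + 1) * \<bar>t\<bar>" if "\<bar>t\<bar> < d" for t
      proof -
        have "norm (c t - \<psi> u) \<le> norm (c t - \<psi> u - t *\<^sub>R w) + norm (t *\<^sub>R w)"
          using norm_triangle_ineq[of "c t - \<psi> u - t *\<^sub>R w" "t *\<^sub>R w"] by simp
        also have "\<dots> \<le> \<bar>t\<bar> + \<bar>t\<bar> * norm w"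
          using d(2)[rule_format, of t] that c(3) by simp
        finally show ?thesis by (simp add: algebra_simps)
      qed
      moreover have "\<forall>\<^sub>F t in at 0. \<bar>t\<bar> < d"
        unfolding eventually_at using d(1) by (auto simp: dist_real_def)
      ultimately show ?thesis by (rule eventually_mono[rotated])
    qed
    have "w \<in> range L"
    proof (rule mem_range_if_orthogonal[OF L(1)])
      fix z assume z: "\<And>a. z \<bullet> L a = 0"
      define K where "K = norm z * (2 / b) * (norm w + 1)"
      have K: "K \<ge> 0" using b(1) by (simp add: K_def)
      have bound: "\<bar>z \<bullet> w\<bar> \<le> K * \<epsilon>" if \<epsilon>: "0 < \<epsilon>" "\<epsilon> \<le> b / 2" for \<epsilon>
      proof -
        have "\<forall>e>0. \<exists>d>0. \<forall>x. norm (x - u) < d \<longrightarrow> norm (\<psi> x - \<psi> u - L (x - u)) \<le> e * norm (x - u)"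
          using d\<psi>[folded L_def] unfolding has_derivative_at_alt by (rule conjunct2)
        from mp[OF spec[OF this, of \<epsilon>] \<epsilon>(1)]
        obtain d where "d > 0 \<and>
          (\<forall>x. norm (x - u) < d \<longrightarrow> norm (\<psi> x - \<psi> u - L (x - u)) \<le> \<epsilon> * norm (x - u))" ..
        note d = conjunct1[OF this] conjunct2[OF this]
        have "\<forall>\<^sub>F t in at 0. norm (\<eta> (c t) - u) < d"
          using tendstoD[OF \<gamma> d(1)] by (simp add: dist_norm)
        then have "\<forall>\<^sub>F t in at 0. norm ((z \<bullet> c t - z \<bullet> \<psi> u) / t) \<le> K * \<epsilon>"
          using in_U quot
        proof eventually_elim
          case (elim t)
          define y where "y = \<eta> (c t)"
          have y: "\<psi> y = c t" using \<eta> elim(2) by (auto simp: homeomorphism_def y_def)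
          have 1: "norm (c t - \<psi> u - L (y - u)) \<le> \<epsilon> * norm (y - u)"
            using d(2)[rule_format, of y] elim(1) y by (simp add: y_def)
          have "b * norm (y - u) \<le> norm (c t - \<psi> u) + \<epsilon> * norm (y - u)"
            using 1 b(2)[of "y - u"] norm_triangle_ineq2[of "L (y - u)" "c t - \<psi> u"]
            unfolding norm_minus_commute[of "L (y - u)"] by linarith
          moreover have "\<epsilon> * norm (y - u) \<le> b / 2 * norm (y - u)"
            using \<epsilon>(2) by (intro mult_right_mono) auto
          ultimately have "b / 2 * norm (y - u) \<le> norm (c t - \<psi> u)" by linarith
          then have 2: "norm (y - u) \<le> 2 / b * norm (c t - \<psi> u)"
            using b(1) by (simp add: field_simps)
          have "\<bar>z \<bullet> c t - z \<bullet> \<psi> u\<bar> = \<bar>z \<bullet> (c t - \<psi> u - L (y - u))\<bar>"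
            using z[of "y - u"] by (simp add: inner_diff_right)
          also have "\<dots> \<le> norm z * norm (c t - \<psi> u - L (y - u))" by (rule Cauchy_Schwarz_ineq2)
          also have "\<dots> \<le> norm z * (\<epsilon> * (2 / b * ((norm w + 1) * \<bar>t\<bar>)))"
          proof (rule mult_left_mono)
            have "norm (y - u) \<le> 2 / b * ((norm w + 1) * \<bar>t\<bar>)"
              using 2 mult_left_mono[OF elim(3), of "2 / b"] b(1) by simp
            then show "norm (c t - \<psi> u - L (y - u)) \<le> \<epsilon> * (2 / b * ((norm w + 1) * \<bar>t\<bar>))"
              by (rule order_trans[OF 1 mult_left_mono[OF _ less_imp_le[OF \<epsilon>(1)]]])
          qed simp
          finally have 3: "\<bar>z \<bullet> c t - z \<bullet> \<psi> u\<bar> \<le> K * \<epsilon> * \<bar>t\<bar>" by (simp add: K_def ac_simps)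
          show ?case
          proof (cases "t = 0")
            case True
            then show ?thesis using K \<epsilon>(1) by simp
          next
            case False
            then show ?thesis using 3 by (simp add: divide_le_eq)
          qed
        qed
        moreover have "((\<lambda>t. (z \<bullet> c t - z \<bullet> \<psi> u) / t) \<longlongrightarrow> z \<bullet> w) (at 0)"
        proof -
          have "((\<lambda>t. z \<bullet> c t) has_vector_derivative z \<bullet> w) (at 0)"
            using bounded_linear.has_vector_derivative[OF bounded_linear_inner_right dc] .
          then have "DERIV (\<lambda>t. z \<bullet> c t) 0 :> z \<bullet> w"
            by (simp add: has_real_derivative_iff_has_vector_derivative)
          then show ?thesis by (simp add: DERIV_def c(3))
        qed
        ultimately have "norm (z \<bullet> w) \<le> K * \<epsilon>"
          by (intro tendsto_upperbound[OF tendsto_norm]) auto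
        then show ?thesis by simp
      qed
      have "\<bar>z \<bullet> w\<bar> \<le> 0"
      proof (rule field_le_epsilon)
        fix \<delta> :: real assume \<delta>: "\<delta> > 0"
        define \<epsilon> where "\<epsilon> = min (b / 2) (\<delta> / (K + 1))"
        have "\<delta> / (K + 1) > 0" using \<delta> K by simp
        then have "0 < \<epsilon>" "\<epsilon> \<le> b / 2" using b(1) unfolding \<epsilon>_def by linarith+
        then have "\<bar>z \<bullet> w\<bar> \<le> K * \<epsilon>" by (rule bound)
        also have "\<dots> \<le> K * (\<delta> / (K + 1))" using K unfolding \<epsilon>_def by (intro mult_left_mono min.cobounded2)
        also have "\<dots> = K / (K + 1) * \<delta>" by simp
        also have "\<dots> \<le> 1 * \<delta>" using K \<delta> by (intro mult_right_mono) simp_all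
        also have "\<dots> = 0 + \<delta>" by simp
        finally show "\<bar>z \<bullet> w\<bar> \<le> 0 + \<delta>" .
      qed
      then show "z \<bullet> w = 0" by simp
    qed
    then show "w \<in> range (\<lambda>a. D a \<psi> u)" by (simp add: L_def)
  qed
qed

lemma tangential_component_properties:
  fixes V :: "'a::euclidean_space \<Rightarrow> 'a"
  assumes "subspace (tangent_space M p)"
  shows "tangential_component M V p \<in> tangent_space M p"
    and "\<And>w. w \<in> tangent_space M p \<Longrightarrow> (V p - tangential_component M V p) \<bullet> w = 0"
proof -
  let ?T = "tangent_space M p"
  have span: "span ?T = ?T" using assms span_eq_iff by blast
  obtain y z where yz: "y \<in> ?T" "\<And>w. w \<in> ?T \<Longrightarrow> orthogonal z w" "V p = y + z"
    using orthogonal_subspace_decomp_exists[of ?T "V p"] unfolding span by metis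
  have "\<exists>!w. w \<in> ?T \<and> V p - w \<in> orthogonal_comp ?T"
  proof (rule ex1I)
    show "y \<in> ?T \<and> V p - y \<in> orthogonal_comp ?T"
      using yz by (auto simp: orthogonal_comp_def orthogonal_commute)
  next
    fix w assume w: "w \<in> ?T \<and> V p - w \<in> orthogonal_comp ?T"
    have "y - w \<in> ?T" using w yz(1) assms by (simp add: subspace_diff)
    then have "(y - w) \<bullet> (V p - w) = 0" "z \<bullet> (y - w) = 0"
      using w yz(2) by (auto simp: orthogonal_comp_def orthogonal_def)
    then have "(y - w) \<bullet> (y - w) = 0"
      by (simp add: yz(3) inner_diff_right inner_diff_left inner_add_right inner_commute)
    then show "w = y" by simp
  qed
  from theI'[OF this]
  show "tangential_component M V p \<in> ?T"
    and "\<And>w. w \<in> ?T \<Longrightarrow> (V p - tangential_component M V p) \<bullet> w = 0"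
    unfolding tangential_component_def by (auto simp: orthogonal_comp_def orthogonal_def inner_commute)
qed

lemma D_frame_expansion:
  fixes \<psi> :: "real^'n \<Rightarrow> 'b::real_normed_vector"
  assumes "smooth_on U \<psi>" "x \<in> U"
  shows "D y \<psi> x = (\<Sum>j\<in>UNIV. y $ j *\<^sub>R D (axis j 1) \<psi> x)"
proof -
  have "D y \<psi> x = D (\<Sum>j\<in>UNIV. y $ j *\<^sub>R axis j 1) \<psi> x"
    using basis_expansion[of y] by (simp add: scalar_mult_eq_scaleR)
  also have "\<dots> = (\<Sum>j\<in>UNIV. y $ j *\<^sub>R D (axis j 1) \<psi> x)"
    using smooth_on_linear_D[OF assms] by (simp add: linear_sum linear_scale)
  finally show ?thesis .
qed

text \<open>Cramer's rule for the Gram matrix exhibits the coordinates \<open>w\<close> of a smooth tangent field as smooth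
  functions. In particular the derivative of \<open>pullback_field\<close> in the coordinate formula for the
  Lie derivative is a genuine derivative.\<close>

lemma smooth_on_preimage_under_derivative:
  fixes \<psi> T :: "real^'n \<Rightarrow> 'a::euclidean_space"
  assumes U: "open U" and s\<psi>: "smooth_on U \<psi>" and sT: "smooth_on U T"
    and inj: "\<And>x. x \<in> U \<Longrightarrow> inj (\<lambda>a. D a \<psi> x)"
    and w: "\<And>x. x \<in> U \<Longrightarrow> D (w x) \<psi> x = T x"
  shows "smooth_on U w"
proof -
  define G :: "real^'n \<Rightarrow> real^'n^'n" where "G x = (\<chi> i j. D (axis i 1) \<psi> x \<bullet> D (axis j 1) \<psi> x)" for x
  define z :: "real^'n \<Rightarrow> real^'n" where "z x = (\<chi> i. D (axis i 1) \<psi> x \<bullet> T x)" for x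
  have Gy: "(G x *v y) $ i = D (axis i 1) \<psi> x \<bullet> D y \<psi> x" if "x \<in> U" for x y i
    unfolding D_frame_expansion[OF s\<psi> that, of y]
    by (simp add: G_def matrix_vector_mult_def inner_sum_right mult.commute)
  have detG: "det (G x) \<noteq> 0" if x: "x \<in> U" for x
  proof -
    have "y = 0" if "G x *v y = 0" for y
    proof -
      have "D y \<psi> x \<bullet> D y \<psi> x = (\<Sum>i\<in>UNIV. y $ i * (G x *v y) $ i)"
        unfolding Gy[OF x] by (subst (1) D_frame_expansion[OF s\<psi> x]) (simp add: inner_sum_left)
      then have "D y \<psi> x = 0" using that by simp
      then show ?thesis using linear_injective_0[OF smooth_on_linear_D[OF s\<psi> x]] inj[OF x] by blast
    qed
    then show ?thesis
      using matrix_left_invertible_ker[of "G x"] invertible_left_inverse invertible_det_nz by blast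
  qed
  have "G x *v w x = z x" if "x \<in> U" for x
    using Gy[OF that, of "w x"] w[OF that] by (simp add: vec_eq_iff z_def)
  then have cr: "w x = (\<chi> k. det (\<chi> i j. if j = k then z x $ i else G x $ i $ j) / det (G x))"
    if "x \<in> U" for x
    using iffD1[OF cramer[OF detG[OF that], of "w x" "z x"]] that by simp
  have sz: "smooth_on U (\<lambda>x. z x $ i)" for i
    unfolding z_def by (simp add: smooth_on_inner[OF U smooth_on_D[OF s\<psi>] sT])
  have sG: "smooth_on U (\<lambda>x. G x $ i $ j)" for i j
    unfolding G_def by (simp add: smooth_on_inner[OF U smooth_on_D[OF s\<psi>] smooth_on_D[OF s\<psi>]])
  have sm: "smooth_on U (\<lambda>x. det (\<chi> i j. if j = k then z x $ i else G x $ i $ j) / det (G x))" for k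
  proof (intro smooth_on_divide smooth_on_det U detG)
    show "smooth_on U (\<lambda>x. (\<chi> i j. if j = k then z x $ i else G x $ i $ j) $ i $ j)" for i j
      using sz sG by (cases "j = k") simp_all
  qed (use sG in simp_all)
  show ?thesis
  proof (rule smooth_on_vec[OF U])
    show "smooth_on U (\<lambda>x. w x $ k)" for k
      using cr by (intro smooth_on_cong[OF U sm[of k]]) simp
  qed
qed

text \<open>The product rule for \<open>T = D\<^sub>w \<psi>\<close> with variable direction \<open>w\<close>, with the second derivative
  already commuted into the form in which it occurs in the Lie derivative.\<close>

lemma D_of_moving_direction:
  fixes \<psi> :: "real^'n \<Rightarrow> 'a::euclidean_space" and w :: "real^'n \<Rightarrow> real^'n"
  assumes U: "open U" and u: "u \<in> U" and s\<psi>: "smooth_on U \<psi>" and sw: "smooth_on U w"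
    and T: "\<And>x. x \<in> U \<Longrightarrow> T x = D (w x) \<psi> x"
  shows "D a T u = D (D a w u) \<psi> u + D (w u) (D a \<psi>) u"
proof -
  have comp: "((\<lambda>x. w x $ j) has_derivative (\<lambda>a. D a w u $ j)) (at u)" for j
    using bounded_linear.has_derivative[OF bounded_linear_vec_nth smooth_on_has_derivative[OF sw u]] .
  have "((\<lambda>x. \<Sum>j\<in>UNIV. w x $ j *\<^sub>R D (axis j 1) \<psi> x) has_derivative
      (\<lambda>a. \<Sum>j\<in>UNIV. w u $ j *\<^sub>R D a (D (axis j 1) \<psi>) u + D a w u $ j *\<^sub>R D (axis j 1) \<psi> u)) (at u)"
    by (intro has_derivative_sum has_derivative_scaleR comp smooth_on_has_derivative[OF smooth_on_D[OF s\<psi>] u])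
  then have "(T has_derivative
      (\<lambda>a. \<Sum>j\<in>UNIV. w u $ j *\<^sub>R D a (D (axis j 1) \<psi>) u + D a w u $ j *\<^sub>R D (axis j 1) \<psi> u)) (at u)"
    by (rule has_derivative_transform_within_open[OF _ U u]) (simp add: T D_frame_expansion[OF s\<psi>, of _ "w _"])
  then have "D a T u = (\<Sum>j\<in>UNIV. w u $ j *\<^sub>R D a (D (axis j 1) \<psi>) u + D a w u $ j *\<^sub>R D (axis j 1) \<psi> u)"
    by (rule D_eqI)
  also have "\<dots> = (\<Sum>j\<in>UNIV. w u $ j *\<^sub>R D (axis j 1) (D a \<psi>) u) + (\<Sum>j\<in>UNIV. D a w u $ j *\<^sub>R D (axis j 1) \<psi> u)"
    unfolding sum.distrib D_commute[OF U u s\<psi>, of a] ..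
  also have "\<dots> = D (w u) (D a \<psi>) u + D (D a w u) \<psi> u"
    by (rule arg_cong2[where f = "(+)"])
      (rule D_frame_expansion[OF smooth_on_D[OF s\<psi>] u, symmetric],
        rule D_frame_expansion[OF s\<psi> u, symmetric])
  finally show ?thesis by simp
qed

section \<open>The soliton equation in a chart\<close>

context
  fixes M :: "'a::euclidean_space set" and \<phi> :: "'a \<Rightarrow> real" and v :: "'a \<Rightarrow> 'a"
    and U :: "(real^'n) set" and \<psi> :: "real^'n \<Rightarrow> 'a"
  assumes soliton: "conformal_soliton TYPE('n) M induced_metric v \<phi>"
    and v: "v = tangential_component M position_field"
    and lp: "local_parametrization M U \<psi>"
begin

lemma subspace_tangent_space: "u \<in> U \<Longrightarrow> subspace (tangent_space M (\<psi> u))"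
  unfolding tangent_space_parametrization[OF lp]
  using linear_subspace_image[OF smooth_on_linear_D[OF local_parametrizationD(2)[OF lp]] subspace_UNIV] .

lemma tangential_field_in_range: "u \<in> U \<Longrightarrow> v (\<psi> u) \<in> range (\<lambda>a. D a \<psi> u)"
  using tangential_component_properties(1)[OF subspace_tangent_space, of u position_field]
  unfolding v by (simp add: tangent_space_parametrization[OF lp])

lemma normal_part_orthogonal:
  assumes "u \<in> U"
  shows "(\<psi> u - v (\<psi> u)) \<bullet> D a \<psi> u = 0"
  using tangential_component_properties(2)[OF subspace_tangent_space[OF assms], of "D a \<psi> u" position_field]
  unfolding v tangent_space_parametrization[OF lp assms] by (auto simp: position_field_def)

lemma smooth_tangential_field: "smooth_on U (\<lambda>u. v (\<psi> u))"
  and smooth_conformal_factor: "smooth_on U (\<lambda>u. \<phi> (\<psi> u))"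
  using soliton lp
  by (auto simp: conformal_soliton_def smooth_vector_field_def smooth_map_on_manifold_def comp_def)

lemma D_pullback_field:
  assumes u: "u \<in> U"
  shows "D (pullback_field \<psi> v u) \<psi> u = v (\<psi> u)"
proof -
  obtain w where w: "D w \<psi> u = v (\<psi> u)" using tangential_field_in_range[OF u] by auto
  have inj: "inj (\<lambda>a. D a \<psi> u)" by (rule local_parametrizationD(3)[OF lp u])
  have "pullback_field \<psi> v u = w"
    unfolding pullback_field_def
  proof (rule the_equality)
    show "D w \<psi> u = v (\<psi> u)" by (rule w)
    fix w' assume "D w' \<psi> u = v (\<psi> u)"
    then show "w' = w" using w injD[OF inj, of w' w] by simp
  qed
  then show ?thesis using w by simp
qed

text \<open>The Lie derivative of the induced metric along \<open>T\<close> equals \<open>D\<^sub>a T \<bullet> D\<^sub>b \<psi> + D\<^sub>b T \<bullet> D\<^sub>a \<psi>\<close>. Differentiating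
  \<open>Q \<bullet> D\<^sub>b \<psi> = 0\<close> gives \<open>D\<^sub>a Q \<bullet> D\<^sub>b \<psi> = - Q \<bullet> D\<^sub>a D\<^sub>b \<psi>\<close>, which is symmetric in \<open>a\<close> and \<open>b\<close>; hence the two terms
  coincide and the soliton equation becomes \<open>D\<^sub>a T \<bullet> D\<^sub>b \<psi> = \<phi> (D\<^sub>a \<psi> \<bullet> D\<^sub>b \<psi>)\<close>.\<close>

lemma normal_part_umbilic:
  assumes u: "u \<in> U"
  shows "D a (\<lambda>u. \<psi> u - v (\<psi> u)) u \<bullet> D b \<psi> u = (1 - \<phi> (\<psi> u)) * (D a \<psi> u \<bullet> D b \<psi> u)"
proof -
  note P = local_parametrizationD[OF lp]
  define T where "T u = v (\<psi> u)" for u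
  define w where "w = pullback_field \<psi> v"
  have sT: "smooth_on U T" unfolding T_def by (rule smooth_tangential_field)
  have wT: "D (w x) \<psi> x = T x" if "x \<in> U" for x
    unfolding w_def T_def by (rule D_pullback_field[OF that])
  have sw: "smooth_on U w" by (rule smooth_on_preimage_under_derivative[OF P(1,2) sT P(3) wT])
  have DT: "D c T u = D (D c w u) \<psi> u + D (w u) (D c \<psi>) u" for c
    by (rule D_of_moving_direction[OF P(1) u P(2) sw wT[symmetric]])
  have "D c (\<lambda>u. \<psi> u - v (\<psi> u)) u = D c \<psi> u - D c T u" for c
    using D_diff[OF P(2) sT u, of c] by (simp add: T_def)
  note DQ = this
  have sQ: "smooth_on U (\<lambda>u. \<psi> u - v (\<psi> u))"
    using smooth_on_diff[OF P(1,2) sT] by (simp add: T_def)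
  have sff: "(D c \<psi> u - D c T u) \<bullet> D d \<psi> u = - ((\<psi> u - v (\<psi> u)) \<bullet> D c (D d \<psi>) u)" for c d
  proof -
    have "D c (\<lambda>u. (\<psi> u - v (\<psi> u)) \<bullet> D d \<psi> u) u = 0"
      by (rule D_const_on_open[OF P(1) u normal_part_orthogonal])
    then show ?thesis
      unfolding D_inner[OF sQ smooth_on_D[OF P(2)] u] DQ by linarith
  qed
  have sym: "D a T u \<bullet> D b \<psi> u = D b T u \<bullet> D a \<psi> u"
    using sff[of a b] sff[of b a] unfolding D_commute[OF P(1) u P(2), of a b]
    by (simp add: inner_diff_left inner_diff_right inner_commute)
  have "\<phi> (\<psi> u) * pullback_metric \<psi> induced_metric u a b
      = 1 / 2 * pullback_lie_derivative \<psi> v induced_metric u a b"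
    using soliton lp u unfolding conformal_soliton_def by blast
  also have "pullback_lie_derivative \<psi> v induced_metric u a b =
      D (w u) (\<lambda>x. D a \<psi> x \<bullet> D b \<psi> x) u + D (D a w u) \<psi> u \<bullet> D b \<psi> u + D a \<psi> u \<bullet> D (D b w u) \<psi> u"
    by (simp add: pullback_lie_derivative_def pullback_metric_def induced_metric_def w_def)
  also have "\<dots> = D a T u \<bullet> D b \<psi> u + D b T u \<bullet> D a \<psi> u"
    unfolding D_inner[OF smooth_on_D[OF P(2)] smooth_on_D[OF P(2)] u] DT
    by (simp add: inner_add_left inner_add_right inner_commute)
  finally have "\<phi> (\<psi> u) * (D a \<psi> u \<bullet> D b \<psi> u) = D a T u \<bullet> D b \<psi> u"
    using sym by (simp add: pullback_metric_def induced_metric_def)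
  then show ?thesis unfolding DQ by (simp add: inner_diff_left left_diff_distrib)
qed

lemma umbilic_patch_restrict:
  assumes "open B" "B \<subseteq> U" and dim: "DIM('a) = CARD('n) + 1" "CARD('n) \<ge> 2"
  shows "umbilic_patch B \<psi> (\<lambda>u. \<psi> u - v (\<psi> u)) (\<lambda>u. 1 - \<phi> (\<psi> u))"
proof
  note P = local_parametrizationD[OF lp]
  note sub = smooth_on_subset[OF _ assms(2)]
  show "smooth_on B \<psi>" by (rule sub[OF P(2)])
  show "smooth_on B (\<lambda>u. \<psi> u - v (\<psi> u))"
    by (rule sub[OF smooth_on_diff[OF P(1,2) smooth_tangential_field]])
  show "smooth_on B (\<lambda>u. 1 - \<phi> (\<psi> u))"
    by (rule sub[OF smooth_on_diff[OF P(1) smooth_on_const smooth_conformal_factor]])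
  show "\<exists>w. \<psi> x - (\<psi> x - v (\<psi> x)) = D w \<psi> x" if "x \<in> B" for x
    using tangential_field_in_range[of x] that assms(2) by auto
qed (use assms local_parametrizationD(3)[OF lp] normal_part_orthogonal normal_part_umbilic in auto)

end

section \<open>Cones, hyperplanes and hyperspheres\<close>

lemma position_field_flow:
  fixes c :: "real \<Rightarrow> 'a::real_normed_vector"
  assumes "\<And>t. (c has_vector_derivative c t) (at t)"
  shows "c t = exp t *\<^sub>R c 0"
proof -
  have "((\<lambda>s. exp (- s) *\<^sub>R c s) has_vector_derivative 0) (at s)" for s
  proof -
    have "((\<lambda>s. exp (- s)) has_real_derivative - exp (- s)) (at s)"
      by (auto intro!: derivative_eq_intros)
    from has_vector_derivative_scaleR[OF this assms[of s]] show ?thesis by simp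
  qed
  then have "exp (- t) *\<^sub>R c t = exp (- 0) *\<^sub>R c 0"
    by (intro has_derivative_zero_unique_connected[OF open_UNIV connected_UNIV])
      (auto simp: has_vector_derivative_def)
  then have "exp t *\<^sub>R (exp (- t) *\<^sub>R c t) = exp t *\<^sub>R c 0" by simp
  then show ?thesis by (simp flip: exp_add)
qed

text \<open>The flow of the position field is dilation by \<open>exp t\<close>, so a set on which it is complete is invariant
  under positive scaling and becomes a cone once the origin is added.\<close>

lemma conic_if_position_field_complete:
  fixes M :: "'a::euclidean_space set"
  assumes "complete_vector_field M v" "\<And>p. p \<in> M \<Longrightarrow> v p = p"
  shows "\<exists>C. cone C \<and> openin (top_of_set C) M"
proof (intro exI conjI)
  have scale: "s *\<^sub>R p \<in> M" if p: "p \<in> M" and s: "s > 0" for p s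
  proof -
    obtain c where c: "c 0 = p" "\<And>t. c t \<in> M" "\<And>t. (c has_vector_derivative v (c t)) (at t)"
      using assms(1) p unfolding complete_vector_field_def by blast
    have "c (ln s) = exp (ln s) *\<^sub>R c 0"
      using c(2,3) assms(2) by (intro position_field_flow) simp
    then show ?thesis using c(1,2) s by (metis exp_ln)
  qed
  show "cone (insert 0 M)"
    unfolding cone_def
  proof (intro ballI allI impI)
    fix x :: 'a and s :: real assume "x \<in> insert 0 M" "s \<ge> 0"
    then show "s *\<^sub>R x \<in> insert 0 M" using scale[of x s] by (cases "s = 0") auto
  qed
  show "openin (top_of_set (insert 0 M)) M"
  proof (cases "0 \<in> M")
    case True
    then show ?thesis by (simp add: insert_absorb)
  next
    case False
    then have "M = insert 0 M \<inter> (- {0})" by auto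
    then show ?thesis using openin_open_Int[of "- {0}" "insert 0 M"] by (simp add: open_Compl)
  qed
qed

lemma quadric_subset_hyperplane_or_sphere:
  assumes unit: "2 * \<mu> * k + e \<bullet> e = 1"
  shows "\<exists>H. quadric \<mu> e k \<subseteq> H \<and> (hyperplane H \<or> hypersphere H)"
proof (cases "\<mu> = 0")
  case True
  then have "e \<noteq> 0" using unit by auto
  then have "hyperplane {x. e \<bullet> x = k}" unfolding hyperplane_def by blast
  moreover have "quadric \<mu> e k \<subseteq> {x. e \<bullet> x = k}"
    using True by (auto simp: quadric_def inner_commute)
  ultimately show ?thesis by blast
next
  case False
  define c where "c = - (1 / \<mu>) *\<^sub>R e"
  have "dist c x = 1 / \<bar>\<mu>\<bar>" if "x \<in> quadric \<mu> e k" for x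
  proof -
    have "norm (\<mu> *\<^sub>R x + e) = 1"
      using quadric_unit_normal[OF that unit] by (simp add: norm_eq_1)
    moreover have "\<mu> *\<^sub>R x + e = \<mu> *\<^sub>R (x - c)"
      using False by (simp add: c_def scaleR_add_right)
    ultimately have "\<bar>\<mu>\<bar> * norm (x - c) = 1" by simp
    then show ?thesis using False by (simp add: dist_norm norm_minus_commute field_simps)
  qed
  then have "quadric \<mu> e k \<subseteq> sphere c (1 / \<bar>\<mu>\<bar>)" by auto
  moreover have "hypersphere (sphere c (1 / \<bar>\<mu>\<bar>))"
    using False unfolding hypersphere_def by (metis divide_pos_pos zero_less_abs_iff zero_less_one)
  ultimately show ?thesis by blast
qed

text \<open>Lying near a given point in the quadric found at one point with \<open>Q \<noteq> 0\<close> is a property \<open>S\<close> that holds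
  on all of a chart ball as soon as it holds somewhere in it, so it spreads over the connected set \<open>M\<close>.\<close>

theorem theorem1p3:
  fixes M :: "'a::euclidean_space set" and \<phi> :: "'a \<Rightarrow> real"
  assumes "CARD('n::finite) \<ge> 2"
    and "hypersurface TYPE('n) M"
    and "conformal_soliton TYPE('n) M induced_metric (tangential_component M position_field) \<phi>"
  shows "\<exists>H. M \<subseteq> H \<and> (hyperplane H \<or> conic_hypersurface TYPE('n) H \<or> hypersphere H)"
proof -
  define v where "v = tangential_component M position_field"
  have soliton: "conformal_soliton TYPE('n) M induced_metric v \<phi>" using assms(3) by (simp add: v_def)
  have dim: "DIM('a) = CARD('n) + 1" and M: "submanifold TYPE('n) M"
    using assms(2) by (auto simp: hypersurface_def)
  then have conn: "connected M" by (simp add: submanifold_def)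
  have chart: "\<exists>(U::(real^'n) set) \<psi>. local_parametrization M U \<psi> \<and> p \<in> \<psi> ` U" if "p \<in> M" for p
    using M that unfolding submanifold_def by blast
  show ?thesis
  proof (cases "\<forall>p\<in>M. v p = p")
    case True
    have "complete_vector_field M v" using soliton by (simp add: conformal_soliton_def)
    then have "conic_hypersurface TYPE('n) M"
      using conic_if_position_field_complete[of M v] True assms(2) M
      unfolding conic_hypersurface_def conic_submanifold_def by blast
    then show ?thesis by blast
  next
    case False
    then obtain p0 where p0: "p0 \<in> M" "v p0 \<noteq> p0" by blast
    obtain U0 :: "(real^'n) set" and \<psi>0 u0 where lp0: "local_parametrization M U0 \<psi>0" "u0 \<in> U0" "p0 = \<psi>0 u0"
      using chart[OF p0(1)] by blast
    note P0 = local_parametrizationD[OF lp0(1)]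
    have "smooth_on U0 (\<lambda>u. \<psi>0 u - v (\<psi>0 u))"
      by (rule smooth_on_diff[OF P0(1,2) smooth_tangential_field[OF soliton v_def lp0(1)]])
    then have "open {u \<in> U0. \<psi>0 u - v (\<psi>0 u) \<noteq> 0}"
      by (rule open_nonzero[OF smooth_on_continuous_on P0(1)])
    moreover have "u0 \<in> {u \<in> U0. \<psi>0 u - v (\<psi>0 u) \<noteq> 0}" using p0(2) lp0(2,3) by simp
    ultimately obtain r where r: "r > 0" "ball u0 r \<subseteq> {u \<in> U0. \<psi>0 u - v (\<psi>0 u) \<noteq> 0}"
      by (rule openE)
    have B: "ball u0 r \<subseteq> U0" "\<forall>u\<in>ball u0 r. \<psi>0 u - v (\<psi>0 u) \<noteq> 0" using r(2) by auto
    interpret patch: umbilic_patch "ball u0 r" \<psi>0 "\<lambda>u. \<psi>0 u - v (\<psi>0 u)" "\<lambda>u. 1 - \<phi> (\<psi>0 u)"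
      by (rule umbilic_patch_restrict[OF soliton v_def lp0(1) open_ball B(1) dim assms(1)])
    have ne: "ball u0 r \<noteq> {}" using r(1) by simp
    obtain \<mu> e k where unit: "2 * \<mu> * k + e \<bullet> e = 1"
      and "\<forall>x\<in>ball u0 r. 1 - \<phi> (\<psi>0 x) = \<mu> * norm (\<psi>0 x - v (\<psi>0 x))"
      and "\<forall>x\<in>ball u0 r. \<psi>0 x - v (\<psi>0 x) = norm (\<psi>0 x - v (\<psi>0 x)) *\<^sub>R (\<mu> *\<^sub>R \<psi>0 x + e)"
      and height: "\<forall>x\<in>ball u0 r. norm (\<psi>0 x - v (\<psi>0 x)) = \<mu> / 2 * (\<psi>0 x \<bullet> \<psi>0 x) + k"
      and quad: "\<psi>0 ` ball u0 r \<subseteq> quadric \<mu> e k"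
      by (rule patch.patch_in_quadric[OF open_ball connected_ball subset_refl ne B(2)]) (rule that)
    \<comment> \<open>For \<open>\<mu> = 0\<close> the constant k is the nonzero length of the normal part.\<close>
    have nondeg: "\<mu> \<noteq> 0 \<or> k \<noteq> 0"
      using bspec[OF height, of u0] bspec[OF B(2), of u0] r(1) by auto
    define S where "S p \<longleftrightarrow> (\<exists>T. openin (top_of_set M) T \<and> p \<in> T \<and> T \<subseteq> quadric \<mu> e k)" for p
    have "S p" if "p \<in> M" for p
    proof (rule connected_induction_simple[OF conn p0(1) that])
      show "S p0"
        unfolding S_def using P0(7)[OF open_ball B(1)] quad lp0(3) r(1)
        by (intro exI[of _ "\<psi>0 ` ball u0 r"]) simp
    next
      fix q assume "q \<in> M"
      then obtain U :: "(real^'n) set" and \<psi> u where lp: "local_parametrization M U \<psi>" "u \<in> U" "q = \<psi> u"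
        using chart by blast
      note P = local_parametrizationD[OF lp(1)]
      obtain r' where r': "r' > 0" "ball u r' \<subseteq> U" using P(1) lp(2) unfolding open_contains_ball by blast
      interpret umbilic_patch "ball u r'" \<psi> "\<lambda>u. \<psi> u - v (\<psi> u)" "\<lambda>u. 1 - \<phi> (\<psi> u)"
        by (rule umbilic_patch_restrict[OF soliton v_def lp(1) open_ball r'(2) dim assms(1)])
      have o: "openin (top_of_set M) (\<psi> ` ball u r')" by (rule P(7)[OF open_ball r'(2)])
      have step: "S y" if x: "x \<in> \<psi> ` ball u r'" "S x" and y: "y \<in> \<psi> ` ball u r'" for x y
      proof -
        obtain T where T: "openin (top_of_set M) T" "x \<in> T" "T \<subseteq> quadric \<mu> e k"
          using x(2) unfolding S_def by (elim exE conjE)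
        obtain O' where O': "open O'" "T = M \<inter> O'" using T(1) by (auto simp: openin_open)
        define A where "A = ball u r' \<inter> \<psi> -` O'"
        have "open A"
          unfolding A_def using smooth_on_continuous_on[OF smooth_\<psi>]
          by (rule continuous_open_preimage[OF _ open_ball O'(1)])
        moreover have "A \<noteq> {}" "A \<subseteq> ball u r'" using x(1) T(2) O'(2) by (auto simp: A_def)
        moreover have "\<psi> ` A \<subseteq> quadric \<mu> e k"
        proof -
          have "\<psi> ` A \<subseteq> M \<inter> O'" using r'(2) P(5) by (auto simp: A_def)
          then show ?thesis using T(3) O'(2) by blast
        qed
        ultimately have "\<psi> ` ball u r' \<subseteq> quadric \<mu> e k"
          by (intro connected_patch_in_quadric[OF connected_ball inj_on_subset[OF P(6) r'(2)] _ _ _ _ unit nondeg])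
        then show ?thesis
          unfolding S_def using o y by (intro exI[of _ "\<psi> ` ball u r'"] conjI)
      qed
      show "\<exists>T. openin (top_of_set M) T \<and> q \<in> T \<and> (\<forall>x\<in>T. \<forall>y\<in>T. S x \<longrightarrow> S y)"
      proof (intro exI[of _ "\<psi> ` ball u r'"] conjI ballI impI)
        show "q \<in> \<psi> ` ball u r'" using lp(3) r'(1) by simp
      qed (rule o, rule step)
    qed
    then have "M \<subseteq> quadric \<mu> e k" by (auto simp: S_def)
    then show ?thesis using quadric_subset_hyperplane_or_sphere[OF unit] by blast
  qed
qed

end
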